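(* Let $F$ be a slant Riemannian submersion from a Sasakian manifold $M(\phi,\xi,\eta,g_M)$ onto a Riemannian manifold $(N,g_N)$. Let $Q=\psi^2$ on $\ker F_*$, where $\psi U$ denotes the vertical component of $\phi U$ for vertical $U$. Then $\nabla Q=0$ if and only if $F$ is an anti-invariant submersion.
   Context: An almost contact metric structure $(\phi,\xi,\eta,g)$ on $M$ consists of a $(1,1)$-tensor field $\phi$, a vector field $\xi$, a 1-form $\eta$ and a Riemannian metric $g$ with $\phi^2=-I+\eta\otimes\xi$, $\phi\xi=0$, $\eta\circ\phi=0$, $\eta(\xi)=1$, $g(\phi X,\phi Y)=g(X,Y)-\eta(X)\eta(Y)$, $\eta(X)=g(X,\xi)$. It is Sasakian if it is a normal contact metric structure; it then satisfies $(\nabla_X\phi)Y=g(X,Y)\xi-\eta(Y)X$ and $\nabla_X\xi=-\phi X$ for the Levi-Civita connection $\nabla$ of $g$. A Riemannian submersion $F:(M,g_M)\to(N,g_N)$ is a smooth surjective map of maximal rank such that $F_*$ preserves lengths of horizontal vectors. Vectors in $\ker F_*$ are vertical, vectors in $(\ker F_* )^\perp$ are horizontal; $\mathcal V$ denotes orthogonal projection onto $\ker F_*$. $F$ is slant if for every nonzero vertical vector $X$ that is not a multiple of $\xi$, the angle $\theta(X)$ between $\phi X$ and the space $\ker F_*$ is a constant $\theta$, independent of the point $p\in M$ and of $X$; $\theta$ is the slant angle. $F$ is anti-invariant if it is slant with $\theta=\pi/2$. For vertical $U$, write $\phi U=\psi U+\omega U$ with $\psi U$ vertical and $\omega U$ horizontal.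 For vertical vector fields $U,V$ put $\hat\nabla_UV=\mathcal V\nabla_UV$ and $(\nabla_UQ)V=\mathcal V\nabla_U(QV)-Q\hat\nabla_UV$; $\nabla Q=0$ means $(\nabla_UQ)V=0$ for all vertical $U,V$. *)

theory Defs
  imports "HOL-Analysis.Analysis" "HOL-Library.Function_Algebras"
begin

section \<open>Pointwise real vector space structure on functions\<close>

instantiation "fun" :: (type, real_vector) real_vector
begin

definition scaleR_fun :: "real \<Rightarrow> ('a \<Rightarrow> 'b) \<Rightarrow> 'a \<Rightarrow> 'b" where
  "scaleR_fun a f = (\<lambda>x. a *\<^sub>R f x)"

instance
  by standard (simp_all add: scaleR_fun_def fun_eq_iff scaleR_add_right scaleR_add_left)

end

lemma scaleR_fun_apply [simp]: "(a *\<^sub>R f) x = a *\<^sub>R f x"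
  by (simp add: scaleR_fun_def)


section \<open>Smooth manifolds\<close>

text \<open>\<open>Ck_on k S f\<close> is meant for open sets \<open>S\<close> of a finite-dimensional space.\<close>

primrec Ck_on :: "nat \<Rightarrow> 'a::euclidean_space set \<Rightarrow> ('a \<Rightarrow> 'b::real_normed_vector) \<Rightarrow> bool" where
  "Ck_on 0 S f \<longleftrightarrow> continuous_on S f"
| "Ck_on (Suc k) S f \<longleftrightarrow> (\<forall>x\<in>S. f differentiable (at x)) \<and>
     (\<forall>v. Ck_on k S (\<lambda>x. frechet_derivative f (at x) v))"

definition smooth_on :: "'a::euclidean_space set \<Rightarrow> ('a \<Rightarrow> 'b::real_normed_vector) \<Rightarrow> bool" where
  "smooth_on S f \<longleftrightarrow> (\<forall>k. Ck_on k S f)"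

text \<open>
  A manifold is given by the whole point type \<open>'m\<close> together with a (not necessarily maximal)
  smooth atlas; the Hausdorff and second countability axioms are imposed by type classes in
  \<open>smooth_atlas\<close>. The model space \<open>'a\<close> fixes the dimension.
\<close>

type_synonym ('m, 'a) atlas = "('m set \<times> ('m \<Rightarrow> 'a)) set"

definition chart :: "('m::topological_space) set \<times> ('m \<Rightarrow> 'a::euclidean_space) \<Rightarrow> bool" where
  "chart = (\<lambda>(U, c). open U \<and> open (c ` U) \<and> homeomorphism U (c ` U) c (inv_into U c))"

definition smooth_atlas ::
    "('m::{t2_space,second_countable_topology}, 'a::euclidean_space) atlas \<Rightarrow> bool" where
  "smooth_atlas A \<longleftrightarrow>
     (\<forall>x\<in>A. chart x) \<and> (\<Union>(U, c)\<in>A. U) = UNIV \<and>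
     (\<forall>(U, c)\<in>A. \<forall>(V, d)\<in>A. smooth_on (c ` (U \<inter> V)) (d \<circ> inv_into U c))"

definition smooth_fun :: "('m, 'a::euclidean_space) atlas \<Rightarrow> ('m \<Rightarrow> real) \<Rightarrow> bool" where
  "smooth_fun A f \<longleftrightarrow> (\<forall>(U, c)\<in>A. smooth_on (c ` U) (f \<circ> inv_into U c))"

definition smooth_map ::
    "('m::topological_space, 'a::euclidean_space) atlas \<Rightarrow>
     ('n::topological_space, 'b::euclidean_space) atlas \<Rightarrow> ('m \<Rightarrow> 'n) \<Rightarrow> bool" where
  "smooth_map A B F \<longleftrightarrow> continuous_on UNIV F \<and>
     (\<forall>(U, c)\<in>A. \<forall>(V, d)\<in>B. smooth_on (c ` (U \<inter> F -` V)) (d \<circ> F \<circ> inv_into U c))"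


section \<open>Tangent vectors, vector fields and tensor fields\<close>

text \<open>
  Tangent vectors at \<open>p\<close> are derivations at \<open>p\<close> of the algebra of smooth functions. As
  HOL functions are total, a derivation takes the value 0 on non-smooth functions, which makes
  equality of derivations agree with equality of HOL functions.
\<close>

type_synonym 'm tvec = "('m \<Rightarrow> real) \<Rightarrow> real"
type_synonym 'm vfield = "'m \<Rightarrow> 'm tvec"

definition tangent_space :: "('m, 'a::euclidean_space) atlas \<Rightarrow> 'm \<Rightarrow> 'm tvec set" where
  "tangent_space A p = {v.
     (\<forall>f. \<not> smooth_fun A f \<longrightarrow> v f = 0) \<and>
     (\<forall>f h a b. smooth_fun A f \<longrightarrow> smooth_fun A h \<longrightarrow>
        v (\<lambda>q. a * f q + b * h q) = a * v f + b * v h) \<and>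
     (\<forall>f h. smooth_fun A f \<longrightarrow> smooth_fun A h \<longrightarrow>
        v (\<lambda>q. f q * h q) = f p * v h + h p * v f)}"

definition pushforward ::
    "('n, 'b::euclidean_space) atlas \<Rightarrow> ('m \<Rightarrow> 'n) \<Rightarrow> 'm tvec \<Rightarrow> 'n tvec" where
  "pushforward B F v = (\<lambda>h. if smooth_fun B h then v (h \<circ> F) else 0)"

definition vector_field :: "('m, 'a::euclidean_space) atlas \<Rightarrow> 'm vfield \<Rightarrow> bool" where
  "vector_field A X \<longleftrightarrow> (\<forall>p. X p \<in> tangent_space A p) \<and>
     (\<forall>f. smooth_fun A f \<longrightarrow> smooth_fun A (\<lambda>p. X p f))"

definition lie_bracket :: "'m vfield \<Rightarrow> 'm vfield \<Rightarrow> 'm vfield" where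
  "lie_bracket X Y = (\<lambda>p f. X p (\<lambda>q. Y q f) - Y p (\<lambda>q. X q f))"

text \<open>
  Tensor fields are families of multilinear maps on the tangent spaces; smoothness is tested
  on smooth vector fields.
\<close>

definition one_form :: "('m, 'a::euclidean_space) atlas \<Rightarrow> ('m \<Rightarrow> 'm tvec \<Rightarrow> real) \<Rightarrow> bool" where
  "one_form A \<eta> \<longleftrightarrow>
     (\<forall>p. \<forall>u\<in>tangent_space A p. \<forall>v\<in>tangent_space A p. \<forall>a b.
        \<eta> p (a *\<^sub>R u + b *\<^sub>R v) = a * \<eta> p u + b * \<eta> p v) \<and>
     (\<forall>X. vector_field A X \<longrightarrow> smooth_fun A (\<lambda>p. \<eta> p (X p)))"

definition tensor_field_11 ::
    "('m, 'a::euclidean_space) atlas \<Rightarrow> ('m \<Rightarrow> 'm tvec \<Rightarrow> 'm tvec) \<Rightarrow> bool" where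
  "tensor_field_11 A \<phi> \<longleftrightarrow>
     (\<forall>p. \<forall>u\<in>tangent_space A p. \<phi> p u \<in> tangent_space A p) \<and>
     (\<forall>p. \<forall>u\<in>tangent_space A p. \<forall>v\<in>tangent_space A p. \<forall>a b.
        \<phi> p (a *\<^sub>R u + b *\<^sub>R v) = a *\<^sub>R \<phi> p u + b *\<^sub>R \<phi> p v) \<and>
     (\<forall>X. vector_field A X \<longrightarrow> vector_field A (\<lambda>p. \<phi> p (X p)))"


section \<open>Riemannian manifolds\<close>

definition riemannian_metric ::
    "('m, 'a::euclidean_space) atlas \<Rightarrow> ('m \<Rightarrow> 'm tvec \<Rightarrow> 'm tvec \<Rightarrow> real) \<Rightarrow> bool" where
  "riemannian_metric A g \<longleftrightarrow>
     (\<forall>p. \<forall>u\<in>tangent_space A p. \<forall>v\<in>tangent_space A p. \<forall>w\<in>tangent_space A p. \<forall>a b.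
        g p (a *\<^sub>R u + b *\<^sub>R v) w = a * g p u w + b * g p v w) \<and>
     (\<forall>p. \<forall>u\<in>tangent_space A p. \<forall>v\<in>tangent_space A p. g p u v = g p v u) \<and>
     (\<forall>p. \<forall>u\<in>tangent_space A p. u \<noteq> 0 \<longrightarrow> g p u u > 0) \<and>
     (\<forall>X Y. vector_field A X \<longrightarrow> vector_field A Y \<longrightarrow> smooth_fun A (\<lambda>p. g p (X p) (Y p)))"

definition riemannian_manifold ::
    "('m::{t2_space,second_countable_topology}, 'a::euclidean_space) atlas \<Rightarrow>
     ('m \<Rightarrow> 'm tvec \<Rightarrow> 'm tvec \<Rightarrow> real) \<Rightarrow> bool" where
  "riemannian_manifold A g \<longleftrightarrow> smooth_atlas A \<and> riemannian_metric A g"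

definition tnorm :: "('m \<Rightarrow> 'm tvec \<Rightarrow> 'm tvec \<Rightarrow> real) \<Rightarrow> 'm \<Rightarrow> 'm tvec \<Rightarrow> real" where
  "tnorm g p v = sqrt (g p v v)"

definition affine_connection ::
    "('m, 'a::euclidean_space) atlas \<Rightarrow> ('m vfield \<Rightarrow> 'm vfield \<Rightarrow> 'm vfield) \<Rightarrow> bool" where
  "affine_connection A D \<longleftrightarrow>
     (\<forall>X Y. vector_field A X \<longrightarrow> vector_field A Y \<longrightarrow> vector_field A (D X Y)) \<and>
     (\<forall>X Y Z. vector_field A X \<longrightarrow> vector_field A Y \<longrightarrow> vector_field A Z \<longrightarrow>
        D (X + Y) Z = D X Z + D Y Z \<and> D X (Y + Z) = D X Y + D X Z) \<and>
     (\<forall>f X Y. smooth_fun A f \<longrightarrow> vector_field A X \<longrightarrow> vector_field A Y \<longrightarrow>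
        D (\<lambda>p. f p *\<^sub>R X p) Y = (\<lambda>p. f p *\<^sub>R D X Y p) \<and>
        D X (\<lambda>p. f p *\<^sub>R Y p) = (\<lambda>p. f p *\<^sub>R D X Y p + X p f *\<^sub>R Y p))"

definition levi_civita ::
    "('m, 'a::euclidean_space) atlas \<Rightarrow> ('m \<Rightarrow> 'm tvec \<Rightarrow> 'm tvec \<Rightarrow> real) \<Rightarrow>
     ('m vfield \<Rightarrow> 'm vfield \<Rightarrow> 'm vfield) \<Rightarrow> bool" where
  "levi_civita A g D \<longleftrightarrow> affine_connection A D \<and>
     (\<forall>X Y. vector_field A X \<longrightarrow> vector_field A Y \<longrightarrow> D X Y - D Y X = lie_bracket X Y) \<and>
     (\<forall>X Y Z p. vector_field A X \<longrightarrow> vector_field A Y \<longrightarrow> vector_field A Z \<longrightarrow>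
        X p (\<lambda>q. g q (Y q) (Z q)) = g p (D X Y p) (Z p) + g p (Y p) (D X Z p))"


section \<open>Sasakian manifolds\<close>

definition almost_contact_metric ::
    "('m, 'a::euclidean_space) atlas \<Rightarrow> ('m \<Rightarrow> 'm tvec \<Rightarrow> 'm tvec) \<Rightarrow> 'm vfield \<Rightarrow>
     ('m \<Rightarrow> 'm tvec \<Rightarrow> real) \<Rightarrow> ('m \<Rightarrow> 'm tvec \<Rightarrow> 'm tvec \<Rightarrow> real) \<Rightarrow> bool" where
  "almost_contact_metric A \<phi> \<xi> \<eta> g \<longleftrightarrow>
     tensor_field_11 A \<phi> \<and> vector_field A \<xi> \<and> one_form A \<eta> \<and> riemannian_metric A g \<and>
     (\<forall>p. \<forall>u\<in>tangent_space A p. \<phi> p (\<phi> p u) = - u + \<eta> p u *\<^sub>R \<xi> p) \<and>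
     (\<forall>p. \<phi> p (\<xi> p) = 0) \<and>
     (\<forall>p. \<forall>u\<in>tangent_space A p. \<eta> p (\<phi> p u) = 0) \<and>
     (\<forall>p. \<eta> p (\<xi> p) = 1) \<and>
     (\<forall>p. \<forall>u\<in>tangent_space A p. \<forall>v\<in>tangent_space A p.
        g p (\<phi> p u) (\<phi> p v) = g p u v - \<eta> p u * \<eta> p v) \<and>
     (\<forall>p. \<forall>u\<in>tangent_space A p. \<eta> p u = g p u (\<xi> p))"

text \<open>
  The normalization with the factor 1/2 and the contact condition
  \<open>d\<eta>(X, Y) = g(X, \<phi> Y)\<close> are Blair's conventions; together with normality they give
  \<open>\<nabla>\<^sub>X \<xi> = - \<phi> X\<close> with exactly this sign and factor.
\<close>

definition ext_deriv :: "('m \<Rightarrow> 'm tvec \<Rightarrow> real) \<Rightarrow> 'm vfield \<Rightarrow> 'm vfield \<Rightarrow> 'm \<Rightarrow> real" where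
  "ext_deriv \<eta> X Y p =
     (X p (\<lambda>q. \<eta> q (Y q)) - Y p (\<lambda>q. \<eta> q (X q)) - \<eta> p (lie_bracket X Y p)) / 2"

definition contact_metric ::
    "('m, 'a::euclidean_space) atlas \<Rightarrow> ('m \<Rightarrow> 'm tvec \<Rightarrow> 'm tvec) \<Rightarrow> 'm vfield \<Rightarrow>
     ('m \<Rightarrow> 'm tvec \<Rightarrow> real) \<Rightarrow> ('m \<Rightarrow> 'm tvec \<Rightarrow> 'm tvec \<Rightarrow> real) \<Rightarrow> bool" where
  "contact_metric A \<phi> \<xi> \<eta> g \<longleftrightarrow> almost_contact_metric A \<phi> \<xi> \<eta> g \<and>
     (\<forall>X Y p. vector_field A X \<longrightarrow> vector_field A Y \<longrightarrow>
        ext_deriv \<eta> X Y p = g p (X p) (\<phi> p (Y p)))"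

definition nijenhuis :: "('m \<Rightarrow> 'm tvec \<Rightarrow> 'm tvec) \<Rightarrow> 'm vfield \<Rightarrow> 'm vfield \<Rightarrow> 'm vfield" where
  "nijenhuis \<phi> X Y p =
     \<phi> p (\<phi> p (lie_bracket X Y p))
     + lie_bracket (\<lambda>q. \<phi> q (X q)) (\<lambda>q. \<phi> q (Y q)) p
     - \<phi> p (lie_bracket (\<lambda>q. \<phi> q (X q)) Y p)
     - \<phi> p (lie_bracket X (\<lambda>q. \<phi> q (Y q)) p)"

definition normal_structure ::
    "('m, 'a::euclidean_space) atlas \<Rightarrow> ('m \<Rightarrow> 'm tvec \<Rightarrow> 'm tvec) \<Rightarrow> 'm vfield \<Rightarrow>
     ('m \<Rightarrow> 'm tvec \<Rightarrow> real) \<Rightarrow> bool" where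
  "normal_structure A \<phi> \<xi> \<eta> \<longleftrightarrow>
     (\<forall>X Y p. vector_field A X \<longrightarrow> vector_field A Y \<longrightarrow>
        nijenhuis \<phi> X Y p + (2 * ext_deriv \<eta> X Y p) *\<^sub>R \<xi> p = 0)"

definition sasakian_manifold ::
    "('m::{t2_space,second_countable_topology}, 'a::euclidean_space) atlas \<Rightarrow>
     ('m \<Rightarrow> 'm tvec \<Rightarrow> 'm tvec) \<Rightarrow> 'm vfield \<Rightarrow>
     ('m \<Rightarrow> 'm tvec \<Rightarrow> real) \<Rightarrow> ('m \<Rightarrow> 'm tvec \<Rightarrow> 'm tvec \<Rightarrow> real) \<Rightarrow> bool" where
  "sasakian_manifold A \<phi> \<xi> \<eta> g \<longleftrightarrow>
     smooth_atlas A \<and> contact_metric A \<phi> \<xi> \<eta> g \<and> normal_structure A \<phi> \<xi> \<eta>"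


section \<open>Riemannian submersions\<close>

definition vertical_space ::
    "('m, 'a::euclidean_space) atlas \<Rightarrow> ('n, 'b::euclidean_space) atlas \<Rightarrow> ('m \<Rightarrow> 'n) \<Rightarrow>
     'm \<Rightarrow> 'm tvec set" where
  "vertical_space A B F p = {v \<in> tangent_space A p. pushforward B F v = 0}"

definition horizontal_space ::
    "('m, 'a::euclidean_space) atlas \<Rightarrow> ('n, 'b::euclidean_space) atlas \<Rightarrow> ('m \<Rightarrow> 'n) \<Rightarrow>
     ('m \<Rightarrow> 'm tvec \<Rightarrow> 'm tvec \<Rightarrow> real) \<Rightarrow> 'm \<Rightarrow> 'm tvec set" where
  "horizontal_space A B F g p =
     {v \<in> tangent_space A p. \<forall>u\<in>vertical_space A B F p. g p v u = 0}"

text \<open>Maximal rank for a submersion means that every differential is onto.\<close>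

definition riemannian_submersion ::
    "('m::topological_space, 'a::euclidean_space) atlas \<Rightarrow>
     ('n::topological_space, 'b::euclidean_space) atlas \<Rightarrow> ('m \<Rightarrow> 'n) \<Rightarrow>
     ('m \<Rightarrow> 'm tvec \<Rightarrow> 'm tvec \<Rightarrow> real) \<Rightarrow> ('n \<Rightarrow> 'n tvec \<Rightarrow> 'n tvec \<Rightarrow> real) \<Rightarrow> bool" where
  "riemannian_submersion A B F gM gN \<longleftrightarrow>
     smooth_map A B F \<and> surj F \<and>
     (\<forall>p. pushforward B F ` tangent_space A p = tangent_space B (F p)) \<and>
     (\<forall>p. \<forall>v\<in>horizontal_space A B F gM p. tnorm gN (F p) (pushforward B F v) = tnorm gM p v)"

definition vproj ::
    "('m, 'a::euclidean_space) atlas \<Rightarrow> ('n, 'b::euclidean_space) atlas \<Rightarrow> ('m \<Rightarrow> 'n) \<Rightarrow>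
     ('m \<Rightarrow> 'm tvec \<Rightarrow> 'm tvec \<Rightarrow> real) \<Rightarrow> 'm \<Rightarrow> 'm tvec \<Rightarrow> 'm tvec" where
  "vproj A B F g p v =
     (THE u. u \<in> vertical_space A B F p \<and> v - u \<in> horizontal_space A B F g p)"

definition vertical_field ::
    "('m, 'a::euclidean_space) atlas \<Rightarrow> ('n, 'b::euclidean_space) atlas \<Rightarrow> ('m \<Rightarrow> 'n) \<Rightarrow>
     'm vfield \<Rightarrow> bool" where
  "vertical_field A B F V \<longleftrightarrow> vector_field A V \<and> (\<forall>p. V p \<in> vertical_space A B F p)"

definition psi ::
    "('m, 'a::euclidean_space) atlas \<Rightarrow> ('n, 'b::euclidean_space) atlas \<Rightarrow> ('m \<Rightarrow> 'n) \<Rightarrow>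
     ('m \<Rightarrow> 'm tvec \<Rightarrow> 'm tvec \<Rightarrow> real) \<Rightarrow> ('m \<Rightarrow> 'm tvec \<Rightarrow> 'm tvec) \<Rightarrow>
     'm \<Rightarrow> 'm tvec \<Rightarrow> 'm tvec" where
  "psi A B F g \<phi> p u = vproj A B F g p (\<phi> p u)"

text \<open>
  The angle between a nonzero vector \<open>v\<close> and a subspace is the angle between \<open>v\<close> and
  its orthogonal projection \<open>w\<close> to the subspace, whose cosine is
  \<open>g(v, w) / (|v| |w|) = |w| / |v|\<close>; for \<open>w = 0\<close> the formula gives \<open>\<pi>/2\<close>.
\<close>

definition angle_vertical ::
    "('m, 'a::euclidean_space) atlas \<Rightarrow> ('n, 'b::euclidean_space) atlas \<Rightarrow> ('m \<Rightarrow> 'n) \<Rightarrow>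
     ('m \<Rightarrow> 'm tvec \<Rightarrow> 'm tvec \<Rightarrow> real) \<Rightarrow> 'm \<Rightarrow> 'm tvec \<Rightarrow> real" where
  "angle_vertical A B F g p v = arccos (tnorm g p (vproj A B F g p v) / tnorm g p v)"

definition slant_submersion_with_angle ::
    "('m::topological_space, 'a::euclidean_space) atlas \<Rightarrow>
     ('n::topological_space, 'b::euclidean_space) atlas \<Rightarrow> ('m \<Rightarrow> 'n) \<Rightarrow>
     ('m \<Rightarrow> 'm tvec \<Rightarrow> 'm tvec) \<Rightarrow> 'm vfield \<Rightarrow>
     ('m \<Rightarrow> 'm tvec \<Rightarrow> 'm tvec \<Rightarrow> real) \<Rightarrow> ('n \<Rightarrow> 'n tvec \<Rightarrow> 'n tvec \<Rightarrow> real) \<Rightarrow> real \<Rightarrow> bool" where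
  "slant_submersion_with_angle A B F \<phi> \<xi> gM gN \<theta> \<longleftrightarrow>
     riemannian_submersion A B F gM gN \<and>
     (\<forall>p. \<forall>X\<in>vertical_space A B F p. X \<noteq> 0 \<longrightarrow> (\<forall>c. X \<noteq> c *\<^sub>R \<xi> p) \<longrightarrow>
        angle_vertical A B F gM p (\<phi> p X) = \<theta>)"

definition slant_submersion ::
    "('m::topological_space, 'a::euclidean_space) atlas \<Rightarrow>
     ('n::topological_space, 'b::euclidean_space) atlas \<Rightarrow> ('m \<Rightarrow> 'n) \<Rightarrow>
     ('m \<Rightarrow> 'm tvec \<Rightarrow> 'm tvec) \<Rightarrow> 'm vfield \<Rightarrow>
     ('m \<Rightarrow> 'm tvec \<Rightarrow> 'm tvec \<Rightarrow> real) \<Rightarrow> ('n \<Rightarrow> 'n tvec \<Rightarrow> 'n tvec \<Rightarrow> real) \<Rightarrow> bool" where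
  "slant_submersion A B F \<phi> \<xi> gM gN \<longleftrightarrow>
     (\<exists>\<theta>. slant_submersion_with_angle A B F \<phi> \<xi> gM gN \<theta>)"

definition anti_invariant_submersion ::
    "('m::topological_space, 'a::euclidean_space) atlas \<Rightarrow>
     ('n::topological_space, 'b::euclidean_space) atlas \<Rightarrow> ('m \<Rightarrow> 'n) \<Rightarrow>
     ('m \<Rightarrow> 'm tvec \<Rightarrow> 'm tvec) \<Rightarrow> 'm vfield \<Rightarrow>
     ('m \<Rightarrow> 'm tvec \<Rightarrow> 'm tvec \<Rightarrow> real) \<Rightarrow> ('n \<Rightarrow> 'n tvec \<Rightarrow> 'n tvec \<Rightarrow> real) \<Rightarrow> bool" where
  "anti_invariant_submersion A B F \<phi> \<xi> gM gN \<longleftrightarrow>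
     slant_submersion_with_angle A B F \<phi> \<xi> gM gN (pi / 2)"

definition nabla_hat ::
    "('m, 'a::euclidean_space) atlas \<Rightarrow> ('n, 'b::euclidean_space) atlas \<Rightarrow> ('m \<Rightarrow> 'n) \<Rightarrow>
     ('m \<Rightarrow> 'm tvec \<Rightarrow> 'm tvec \<Rightarrow> real) \<Rightarrow> ('m vfield \<Rightarrow> 'm vfield \<Rightarrow> 'm vfield) \<Rightarrow>
     'm vfield \<Rightarrow> 'm vfield \<Rightarrow> 'm vfield" where
  "nabla_hat A B F g D U V p = vproj A B F g p (D U V p)"

definition nabla_endo ::
    "('m, 'a::euclidean_space) atlas \<Rightarrow> ('n, 'b::euclidean_space) atlas \<Rightarrow> ('m \<Rightarrow> 'n) \<Rightarrow>
     ('m \<Rightarrow> 'm tvec \<Rightarrow> 'm tvec \<Rightarrow> real) \<Rightarrow> ('m vfield \<Rightarrow> 'm vfield \<Rightarrow> 'm vfield) \<Rightarrow>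
     ('m \<Rightarrow> 'm tvec \<Rightarrow> 'm tvec) \<Rightarrow> 'm vfield \<Rightarrow> 'm vfield \<Rightarrow> 'm vfield" where
  "nabla_endo A B F g D Q U V p =
     vproj A B F g p (D U (\<lambda>q. Q q (V q)) p) - Q p (nabla_hat A B F g D U V p)"

definition vertically_parallel ::
    "('m, 'a::euclidean_space) atlas \<Rightarrow> ('n, 'b::euclidean_space) atlas \<Rightarrow> ('m \<Rightarrow> 'n) \<Rightarrow>
     ('m \<Rightarrow> 'm tvec \<Rightarrow> 'm tvec \<Rightarrow> real) \<Rightarrow> ('m vfield \<Rightarrow> 'm vfield \<Rightarrow> 'm vfield) \<Rightarrow>
     ('m \<Rightarrow> 'm tvec \<Rightarrow> 'm tvec) \<Rightarrow> bool" where
  "vertically_parallel A B F g D Q \<longleftrightarrow>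
     (\<forall>U V. vertical_field A B F U \<longrightarrow> vertical_field A B F V \<longrightarrow>
        nabla_endo A B F g D Q U V = 0)"

end

theory Submission
  imports Defs
begin

text \<open>
  On a slant submersion with angle \<open>\<theta>\<close> the endomorphism \<open>Q\<close> of the vertical bundle is
  \<open>- cos\<^sup>2 \<theta> (I - \<eta> \<otimes> \<eta>\<^sup>\<sharp>)\<close>, where \<open>\<eta>\<^sup>\<sharp>\<close> is the vertical part of \<open>\<xi>\<close>.
  If \<open>cos \<theta> \<noteq> 0\<close> and \<open>\<nabla>Q = 0\<close>, then the symmetric product of \<open>\<eta>\<close> and
  \<open>\<nabla>\<^sub>U \<eta>\<close> vanishes along the fibres, so \<open>\<nabla>\<eta> = 0\<close>, hence \<open>d\<eta> = 0\<close>, on vertical vectors wherever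
  \<open>\<eta>\<close> does not vanish on them. Where \<open>\<eta>\<close> vanishes on vertical vectors in a neighbourhood,
  \<open>d\<eta> = 0\<close> because the vertical distribution is integrable. By the contact condition
  \<open>d\<eta>(U, V) = g(U, \<phi> V)\<close> this forces \<open>\<psi> = 0\<close>. Conversely \<open>\<theta> = \<pi>/2\<close> gives \<open>\<psi> = 0\<close> and \<open>Q = 0\<close>.

  As tangent vectors are abstract derivations, the orthogonal splitting into vertical and
  horizontal vectors rests on Hadamard's lemma (tangent spaces have finite dimension), and the
  smoothness of the vertical projection on a Gram-Schmidt process for gradients of the functions
  \<open>y\<^sub>j \<circ> F\<close>, with \<open>y\<^sub>j\<close> coordinates of the target.
\<close>

section \<open>Calculus of smooth functions\<close>

text \<open>A derivative at \<open>x\<close> depends only on values near \<open>x\<close>; as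
  \<open>S\<close> is open, equality on \<open>S\<close> passes to derivatives of every
  order.\<close>

lemma Ck_on_cong:
  assumes "open S" "\<And>x. x \<in> S \<Longrightarrow> f x = g x" "Ck_on k S f"
  shows "Ck_on k S g"
  using assms(2,3)
proof (induction k arbitrary: f g)
  case 0
  then show ?case by (simp cong: continuous_on_cong)
next
  case (Suc k)
  have d: "(g has_derivative frechet_derivative f (at x)) (at x)" if "x \<in> S" for x
  proof -
    have "(f has_derivative frechet_derivative f (at x)) (at x)"
      using Suc.prems that by (simp add: frechet_derivative_works[symmetric])
    then show ?thesis
      using has_derivative_transform_within_open[OF _ assms(1) that] Suc.prems(1) by blast
  qed
  then have "frechet_derivative g (at x) = frechet_derivative f (at x)" if "x \<in> S" for x
    using that frechet_derivative_at by metis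
  then have "Ck_on k S (\<lambda>x. frechet_derivative g (at x) v)" for v
    using Suc.IH[of "\<lambda>x. frechet_derivative f (at x) v"] Suc.prems by simp
  then show ?case using d differentiableI by fastforce
qed

text \<open>Derivatives at a point are unique, so any explicit formula \<open>f'\<close> can stand
  in for \<open>frechet_derivative\<close>. Most closure rules below are inductions on
  \<open>k\<close> through this rule.\<close>

lemma Ck_on_SucI:
  assumes "open S" "\<And>x. x \<in> S \<Longrightarrow> (f has_derivative f' x) (at x)"
    "\<And>v. Ck_on k S (\<lambda>x. f' x v)"
  shows "Ck_on (Suc k) S f"
proof -
  have "f' x = frechet_derivative f (at x)" if "x \<in> S" for x
    using frechet_derivative_at assms(2)[OF that] by blast
  then have "Ck_on k S (\<lambda>x. frechet_derivative f (at x) v)" for v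
    using Ck_on_cong[OF assms(1) _ assms(3)] by simp
  then show ?thesis using assms(2) differentiableI by fastforce
qed

lemma Ck_on_SucD:
  assumes "Ck_on (Suc k) S f"
  shows "x \<in> S \<Longrightarrow> (f has_derivative frechet_derivative f (at x)) (at x)"
    "Ck_on k S (\<lambda>x. frechet_derivative f (at x) v)"
  using assms by (auto simp: frechet_derivative_works[symmetric])

lemma Ck_on_Suc_imp: "Ck_on (Suc k) S f \<Longrightarrow> Ck_on k S f"
proof (induction k arbitrary: f)
  case 0
  then show ?case
    by (auto intro!: continuous_at_imp_continuous_on differentiable_imp_continuous_within)
next
  case (Suc k)
  have "Ck_on k S (\<lambda>x. frechet_derivative f (at x) v)" for v
    using Suc.IH Ck_on_SucD(2)[OF Suc.prems] by blast
  then show ?case using Suc.prems by simp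
qed

lemma Ck_on_subset: "Ck_on k S f \<Longrightarrow> T \<subseteq> S \<Longrightarrow> Ck_on k T f"
proof (induction k arbitrary: f)
  case 0
  then show ?case by (simp add: continuous_on_subset)
next
  case (Suc k)
  then show ?case by auto
qed

text \<open>Serves to glue smoothness from the pieces of an open cover.\<close>

lemma Ck_on_Union:
  assumes "\<And>x. x \<in> S \<Longrightarrow> \<exists>T. open T \<and> x \<in> T \<and> Ck_on k T f"
  shows "Ck_on k S f"
  using assms
proof (induction k arbitrary: f)
  case 0
  have "isCont f x" if "x \<in> S" for x
    using 0[OF that] by (auto simp: continuous_on_eq_continuous_at)
  then show ?case by (simp add: continuous_at_imp_continuous_on)
next
  case (Suc k)
  have "f differentiable at x" if "x \<in> S" for x
    using Suc.prems[OF that] by auto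
  moreover have "Ck_on k S (\<lambda>x. frechet_derivative f (at x) v)" for v
    by (rule Suc.IH) (use Suc.prems in fastforce)
  ultimately show ?case by simp
qed

section \<open>Closure of the class C^k under algebraic operations and composition\<close>

lemma Ck_on_const: "Ck_on k S (\<lambda>x. c)"
  by (induction k arbitrary: c) (auto)

lemma Ck_on_bounded_linear:
  assumes "open S" "bounded_linear L" "Ck_on k S f"
  shows "Ck_on k S (\<lambda>x. L (f x))"
  using assms(3)
proof (induction k arbitrary: f)
  case 0
  then show ?case using bounded_linear.continuous_on[OF assms(2)] by auto
next
  case (Suc k)
  show ?case
    by (rule Ck_on_SucI[OF assms(1), where f' = "\<lambda>x v. L (frechet_derivative f (at x) v)"])
      (auto intro!: bounded_linear.has_derivative[OF assms(2)] Ck_on_SucD[OF Suc.prems]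
        Suc.IH simp del: Ck_on.simps)
qed

lemma Ck_on_ident: assumes "open S" shows "Ck_on k S (\<lambda>x. x)"
proof (cases k)
  case (Suc n)
  show ?thesis unfolding Suc
    by (rule Ck_on_SucI[OF assms, where f' = "\<lambda>x v. v"]) (auto simp: Ck_on_const)
qed auto

lemma Ck_on_add:
  assumes "open S" "Ck_on k S f" "Ck_on k S g"
  shows "Ck_on k S (\<lambda>x. f x + g x)"
  using assms(2,3)
proof (induction k arbitrary: f g)
  case 0
  then show ?case by (auto intro: continuous_on_add)
next
  case (Suc k)
  show ?case
    by (rule Ck_on_SucI[OF assms(1)], rule has_derivative_add)
      (auto intro: Ck_on_SucD(1) Suc.prems Suc.IH Ck_on_SucD(2)[OF Suc.prems(1)]
        Ck_on_SucD(2)[OF Suc.prems(2)] simp del: Ck_on.simps)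
qed

lemma Ck_on_mult:
  fixes f g :: "'a::euclidean_space \<Rightarrow> real"
  assumes "open S" "Ck_on k S f" "Ck_on k S g"
  shows "Ck_on k S (\<lambda>x. f x * g x)"
  using assms(2,3)
proof (induction k arbitrary: f g)
  case 0
  then show ?case by (auto intro: continuous_on_mult)
next
  case (Suc k)
  show ?case
  proof (rule Ck_on_SucI[OF assms(1)], rule has_derivative_mult)
    fix v
    show "Ck_on k S (\<lambda>x. f x * frechet_derivative g (at x) v + frechet_derivative f (at x) v * g x)"
      by (intro Ck_on_add assms(1) Suc.IH Suc.prems[THEN Ck_on_Suc_imp] Suc.prems[THEN Ck_on_SucD(2)])
  qed (auto intro: Ck_on_SucD(1) Suc.prems simp del: Ck_on.simps)
qed

lemma Ck_on_sum:
  assumes "open S" "\<And>i. i \<in> I \<Longrightarrow> Ck_on k S (f i)"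
  shows "Ck_on k S (\<lambda>x. \<Sum>i\<in>I. f i x)"
proof (cases "finite I")
  case True
  then show ?thesis using assms(2)
    by (induction I rule: finite_induct) (auto intro: Ck_on_const Ck_on_add assms(1))
qed (simp add: Ck_on_const)

text \<open>The derivative of \<open>1 / f\<close> is a product of \<open>f'\<close> with two
  factors \<open>1 / f\<close>, all of lower class and already known, so the induction keeps
  \<open>f\<close> fixed.\<close>

lemma Ck_on_inverse:
  fixes f :: "'a::euclidean_space \<Rightarrow> real"
  assumes "open S" "\<And>x. x \<in> S \<Longrightarrow> f x \<noteq> 0" "Ck_on k S f"
  shows "Ck_on k S (\<lambda>x. inverse (f x))"
  using assms(3)
proof (induction k)
  case 0
  then show ?case using assms(2) by (auto intro: continuous_on_inverse)
next
  case (Suc k)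
  have 1: "Ck_on k S (\<lambda>x. inverse (f x))" using Suc Ck_on_Suc_imp by blast
  show ?case
  proof (rule Ck_on_SucI[OF assms(1)], rule Deriv.has_derivative_inverse)
    fix v
    have "Ck_on k S (\<lambda>x. (-1) * (inverse (f x) * frechet_derivative f (at x) v * inverse (f x)))"
      by (intro Ck_on_mult Ck_on_const 1 assms(1) Ck_on_SucD(2) Suc.prems)
    then show "Ck_on k S (\<lambda>x. - (inverse (f x) * frechet_derivative f (at x) v * inverse (f x)))"
      by simp
  qed (auto intro: Ck_on_SucD(1) Suc.prems dest: assms(2) simp del: Ck_on.simps)
qed

lemma Ck_on_compose:
  fixes f :: "'b::euclidean_space \<Rightarrow> real" and g :: "'a::euclidean_space \<Rightarrow> 'b"
  assumes "open S" "open T" "g ` S \<subseteq> T" "Ck_on k S g" "Ck_on k T f"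
  shows "Ck_on k S (\<lambda>x. f (g x))"
  using assms(4,5)
proof (induction k arbitrary: f)
  case 0
  then show ?case using continuous_on_compose2 assms(3) by auto
next
  case (Suc k)
  let ?d = "\<lambda>x v. frechet_derivative g (at x) v"
  show ?case
  \<comment> \<open>The derivative of \<open>f\<close> is expanded over \<open>Basis\<close> to get
    a sum of products; for fixed \<open>b\<close> the factor
    \<open>frechet_derivative f (at (g x)) b\<close> is again a composite with \<open>g\<close>, to
    which the induction hypothesis applies.\<close>
  proof (rule Ck_on_SucI[OF assms(1), where f' = "\<lambda>x v. \<Sum>b\<in>Basis. (?d x v \<bullet> b) *
        frechet_derivative f (at (g x)) b"])
    fix x assume x: "x \<in> S"
    have gx: "g x \<in> T" using x assms(3) by blast
    have l: "linear (frechet_derivative f (at (g x)))"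
      using Suc.prems(2) gx by (auto intro: linear_frechet_derivative)
    have "((\<lambda>x. f (g x)) has_derivative (\<lambda>v. frechet_derivative f (at (g x)) (?d x v))) (at x)"
      using has_derivative_compose[OF Ck_on_SucD(1)[OF Suc.prems(1) x] Ck_on_SucD(1)[OF Suc.prems(2) gx]] .
    moreover have "frechet_derivative f (at (g x)) u =
        (\<Sum>b\<in>Basis. (u \<bullet> b) * frechet_derivative f (at (g x)) b)" for u
      by (subst euclidean_representation[of u, symmetric])
        (simp only: linear_sum[OF l] linear_cmul[OF l] real_scaleR_def)
    ultimately show "((\<lambda>x. f (g x)) has_derivative (\<lambda>v. \<Sum>b\<in>Basis. (?d x v \<bullet> b) *
        frechet_derivative f (at (g x)) b)) (at x)"
      by (rule has_derivative_eq_rhs[OF _ ext])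
  next
    fix v
    show "Ck_on k S (\<lambda>x. \<Sum>b\<in>Basis. (?d x v \<bullet> b) * frechet_derivative f (at (g x)) b)"
      by (intro Ck_on_sum assms(1) Ck_on_mult Ck_on_bounded_linear[OF _ bounded_linear_inner_left]
          Suc.IH Ck_on_Suc_imp[OF Suc.prems(1)] Ck_on_SucD(2) Suc.prems)
  qed
qed

section \<open>The same closure properties for smooth functions\<close>

lemma smooth_on_cong: "open S \<Longrightarrow> (\<And>x. x \<in> S \<Longrightarrow> f x = g x) \<Longrightarrow> smooth_on S f \<Longrightarrow> smooth_on S g"
  unfolding smooth_on_def using Ck_on_cong by blast

lemma smooth_on_subset: "smooth_on S f \<Longrightarrow> T \<subseteq> S \<Longrightarrow> smooth_on T f"
  unfolding smooth_on_def using Ck_on_subset by blast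

lemma smooth_on_Union:
  "(\<And>x. x \<in> S \<Longrightarrow> \<exists>T. open T \<and> x \<in> T \<and> smooth_on T f) \<Longrightarrow> smooth_on S f"
  unfolding smooth_on_def using Ck_on_Union by meson

lemma smooth_on_const: "smooth_on S (\<lambda>x. c)"
  by (simp add: smooth_on_def Ck_on_const)

lemma smooth_on_ident: "open S \<Longrightarrow> smooth_on S (\<lambda>x. x)"
  by (simp add: smooth_on_def Ck_on_ident)

lemma smooth_on_bounded_linear:
  "open S \<Longrightarrow> bounded_linear L \<Longrightarrow> smooth_on S f \<Longrightarrow> smooth_on S (\<lambda>x. L (f x))"
  by (simp add: smooth_on_def Ck_on_bounded_linear)

lemma smooth_on_add: "open S \<Longrightarrow> smooth_on S f \<Longrightarrow> smooth_on S g \<Longrightarrow> smooth_on S (\<lambda>x. f x + g x)"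
  by (simp add: smooth_on_def Ck_on_add)

lemma smooth_on_mult:
  fixes f g :: "'a::euclidean_space \<Rightarrow> real"
  shows "open S \<Longrightarrow> smooth_on S f \<Longrightarrow> smooth_on S g \<Longrightarrow> smooth_on S (\<lambda>x. f x * g x)"
  by (simp add: smooth_on_def Ck_on_mult)

lemma smooth_on_divide:
  fixes f g :: "'a::euclidean_space \<Rightarrow> real"
  shows "open S \<Longrightarrow> smooth_on S f \<Longrightarrow> smooth_on S g \<Longrightarrow> (\<And>x. x \<in> S \<Longrightarrow> g x \<noteq> 0) \<Longrightarrow>
    smooth_on S (\<lambda>x. f x / g x)"
  by (simp add: smooth_on_def divide_inverse Ck_on_mult Ck_on_inverse)

lemma smooth_on_sum:
  "open S \<Longrightarrow> (\<And>i. i \<in> I \<Longrightarrow> smooth_on S (f i)) \<Longrightarrow> smooth_on S (\<lambda>x. \<Sum>i\<in>I. f i x)"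
  by (simp add: smooth_on_def Ck_on_sum)

lemma smooth_on_compose:
  fixes f :: "'b::euclidean_space \<Rightarrow> real" and g :: "'a::euclidean_space \<Rightarrow> 'b"
  shows "open S \<Longrightarrow> open T \<Longrightarrow> g ` S \<subseteq> T \<Longrightarrow> smooth_on S g \<Longrightarrow> smooth_on T f \<Longrightarrow>
    smooth_on S (\<lambda>x. f (g x))"
  unfolding smooth_on_def using Ck_on_compose by blast

lemma smooth_on_frechet:
  assumes "smooth_on S f"
  shows "x \<in> S \<Longrightarrow> (f has_derivative frechet_derivative f (at x)) (at x)"
    "smooth_on S (\<lambda>x. frechet_derivative f (at x) v)"
  using assms unfolding smooth_on_def by (metis Ck_on_SucD(1), metis Ck_on_SucD(2))

lemma smooth_on_imp_continuous_on: "smooth_on S f \<Longrightarrow> continuous_on S f"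
  unfolding smooth_on_def by (metis Ck_on.simps(1))

subsection \<open>Hadamard's lemma\<close>

lemma segment_param_in_ball:
  fixes a :: "'a::euclidean_space"
  assumes "x \<in> ball a r" "t \<in> {0..1::real}"
  shows "a + t *\<^sub>R (x - a) \<in> ball a r"
  using assms mult_left_le_one_le[of "norm (x - a)" t]
  by (auto simp: dist_norm norm_minus_commute)

text \<open>Differentiation under the integral sign. The inner map
  \<open>a + t *\<^sub>R (x - a)\<close> contributes a factor \<open>t\<close>, so the exponent
  rises by one; the general moment \<open>t ^ m\<close> makes the family of such integrals closed
  under differentiation.\<close>

lemma has_derivative_integral_moment:
  fixes f :: "'a::euclidean_space \<Rightarrow> real"
  assumes f: "smooth_on (ball a r) f" and x: "x \<in> ball a r"
  shows "((\<lambda>x. integral {0..1} (\<lambda>t. t ^ m * f (a + t *\<^sub>R (x - a)))) has_derivative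
    (\<lambda>v. integral {0..1} (\<lambda>t. t ^ Suc m * frechet_derivative f (at (a + t *\<^sub>R (x - a))) v))) (at x)"
proof -
  let ?B = "ball a r"
  \<comment> \<open>\<open>leibniz_rule\<close> wants the derivative as a bounded linear function
    depending continuously on \<open>(x, t)\<close>; the expansion over \<open>Basis\<close> reduces
    this to continuity of partial derivatives.\<close>
  let ?D = "\<lambda>x t. \<Sum>b\<in>Basis. (t ^ Suc m * frechet_derivative f (at (a + t *\<^sub>R (x - a))) b) *\<^sub>R
    blinfun_inner_left b"
  have cD: "continuous_on ?B (\<lambda>x. frechet_derivative f (at x) v)" for v
    using f smooth_on_frechet(2) smooth_on_imp_continuous_on by blast
  have rep: "blinfun_apply (?D x t) v = t ^ Suc m * frechet_derivative f (at (a + t *\<^sub>R (x - a))) v"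
    if "x \<in> ?B" "t \<in> {0..1}" for x t v
  proof -
    have l: "linear (frechet_derivative f (at (a + t *\<^sub>R (x - a))))"
      using smooth_on_frechet(1)[OF f segment_param_in_ball[OF that]] has_derivative_linear by blast
    have "frechet_derivative f (at (a + t *\<^sub>R (x - a))) v =
      (\<Sum>b\<in>Basis. (v \<bullet> b) * frechet_derivative f (at (a + t *\<^sub>R (x - a))) b)"
      by (subst euclidean_representation[of v, symmetric])
        (simp only: linear_sum[OF l] linear_cmul[OF l] real_scaleR_def)
    then show ?thesis
      by (simp add: blinfun.sum_left blinfun.scaleR_left sum_distrib_left mult_ac inner_commute)
  qed
  have contD: "continuous_on (?B \<times> cbox 0 (1::real)) (\<lambda>(x, t). ?D x t)"
    unfolding split_beta
    by (intro continuous_intros continuous_on_compose2[OF cD])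
      (use segment_param_in_ball[of _ a r] in \<open>auto simp del: mem_ball\<close>)
  have contf: "continuous_on ?B f" by (rule smooth_on_imp_continuous_on[OF f])
  have int: "(\<lambda>t. t ^ m * f (a + t *\<^sub>R (x - a))) integrable_on cbox 0 1" if "x \<in> ?B" for x
    by (intro integrable_continuous continuous_intros continuous_on_compose2[OF contf])
      (use segment_param_in_ball[OF that] in \<open>auto simp del: mem_ball\<close>)
  have L: "((\<lambda>x. integral (cbox 0 1) (\<lambda>t. t ^ m * f (a + t *\<^sub>R (x - a)))) has_derivative
      blinfun_apply (integral (cbox 0 1) (?D x))) (at x within ?B)"
  proof (rule leibniz_rule[OF _ int contD x convex_ball])
    fix y and t :: real assume y: "y \<in> ?B" and "t \<in> cbox 0 1"
    then have t: "t \<in> {0..1}" by simp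
    have "((\<lambda>y. a + t *\<^sub>R (y - a)) has_derivative (\<lambda>v. t *\<^sub>R v)) (at y within ?B)"
      by (auto intro!: derivative_eq_intros)
    note has_derivative_compose[OF this smooth_on_frechet(1)[OF f segment_param_in_ball[OF y t]]]
    from has_derivative_mult_right[OF this, of "t ^ m"]
    show "((\<lambda>x. t ^ m * f (a + t *\<^sub>R (x - a))) has_derivative blinfun_apply (?D y t)) (at y within ?B)"
    proof (rule has_derivative_eq_rhs)
      have l: "linear (frechet_derivative f (at (a + t *\<^sub>R (y - a))))"
        using smooth_on_frechet(1)[OF f segment_param_in_ball[OF y t]] has_derivative_linear by blast
      show "(\<lambda>x. t ^ m * frechet_derivative f (at (a + t *\<^sub>R (y - a))) (t *\<^sub>R x)) = blinfun_apply (?D y t)"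
        using rep[OF y t] by (auto simp: linear_cmul[OF l])
    qed
  qed
  have R: "blinfun_apply (integral (cbox 0 1) (?D x)) v =
      integral {0..1} (\<lambda>t. t ^ Suc m * frechet_derivative f (at (a + t *\<^sub>R (x - a))) v)" for v
  proof -
    have "(?D x) integrable_on cbox 0 1"
      by (intro integrable_continuous continuous_intros continuous_on_compose2[OF cD])
        (use segment_param_in_ball[OF x] in \<open>auto simp del: mem_ball\<close>)
    then have "blinfun_apply (integral (cbox 0 1) (?D x)) v = integral (cbox 0 1) (\<lambda>t. blinfun_apply (?D x t) v)"
      by (rule blinfun_apply_integral)
    also have "\<dots> = integral (cbox 0 1) (\<lambda>t. t ^ Suc m * frechet_derivative f (at (a + t *\<^sub>R (x - a))) v)"
      by (rule Henstock_Kurzweil_Integration.integral_cong) (use rep[OF x] in auto)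
    finally show ?thesis by simp
  qed
  show ?thesis
    by (rule has_derivative_eq_rhs[OF L[unfolded at_within_open[OF x open_ball] cbox_interval] ext])
      (rule R[unfolded cbox_interval])
qed

text \<open>The derivative in direction \<open>v\<close> is an integral of the same kind, with the
  directional derivative of \<open>f\<close> and with \<open>m + 1\<close>; hence the induction
  generalises both \<open>f\<close> and \<open>m\<close>.\<close>

lemma smooth_on_integral_moment:
  fixes f :: "'a::euclidean_space \<Rightarrow> real"
  assumes "smooth_on (ball a r) f"
  shows "smooth_on (ball a r) (\<lambda>x. integral {0..1} (\<lambda>t. t ^ m * f (a + t *\<^sub>R (x - a))))"
proof -
  have "Ck_on k (ball a r) (\<lambda>x. integral {0..1} (\<lambda>t. t ^ m * f (a + t *\<^sub>R (x - a))))" for k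
    using assms
  proof (induction k arbitrary: f m)
    case 0
    show ?case
      using has_derivative_integral_moment[OF 0]
      by (auto intro!: continuous_at_imp_continuous_on intro: has_derivative_continuous simp del: mem_ball)
  next
    case (Suc k)
    show ?case
      by (rule Ck_on_SucI[OF open_ball has_derivative_integral_moment[OF Suc.prems]])
        (auto intro: Suc.IH smooth_on_frechet(2)[OF Suc.prems] simp del: power_Suc)
  qed
  then show ?thesis by (simp add: smooth_on_def)
qed

text \<open>The coefficient \<open>h b\<close> averages the partial derivative in direction
  \<open>b\<close> over the segment from \<open>a\<close> to \<open>x\<close>; the expansion is the
  fundamental theorem of calculus along that segment.\<close>

lemma hadamard:
  fixes f :: "'a::euclidean_space \<Rightarrow> real"
  assumes f: "smooth_on (ball a r) f" and r: "r > 0"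
  shows "\<exists>h. (\<forall>b\<in>Basis. smooth_on (ball a r) (h b) \<and> h b a = frechet_derivative f (at a) b) \<and>
    (\<forall>x\<in>ball a r. f x = f a + (\<Sum>b\<in>Basis. ((x - a) \<bullet> b) * h b x))"
proof (intro exI conjI ballI)
  \<comment> \<open>The factor \<open>t ^ 0\<close> presents the average as the moment with
    \<open>m = 0\<close>, whose smoothness is known.\<close>
  let ?h = "\<lambda>b x. integral {0..1} (\<lambda>t. t ^ 0 * frechet_derivative f (at (a + t *\<^sub>R (x - a))) b)"
  fix b :: 'a assume "b \<in> Basis"
  show "smooth_on (ball a r) (?h b)"
    by (rule smooth_on_integral_moment) (rule smooth_on_frechet(2)[OF f])
  show "?h b a = frechet_derivative f (at a) b" by simp
next
  let ?h = "\<lambda>b x. integral {0..1} (\<lambda>t. t ^ 0 * frechet_derivative f (at (a + t *\<^sub>R (x - a))) b)"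
  fix x assume x: "x \<in> ball a r"
  let ?g = "\<lambda>t. frechet_derivative f (at (a + t *\<^sub>R (x - a)))"
  have seg: "a + t *\<^sub>R (x - a) \<in> ball a r" if "t \<in> {0..1}" for t
    using segment_param_in_ball[OF x that] .
  have rep: "?g t (x - a) = (\<Sum>b\<in>Basis. ((x - a) \<bullet> b) * ?g t b)" if "t \<in> {0..1}" for t
  proof -
    have l: "linear (?g t)"
      using smooth_on_frechet(1)[OF f seg[OF that]] has_derivative_linear by blast
    show ?thesis
      by (subst euclidean_representation[of "x - a", symmetric])
        (simp only: linear_sum[OF l] linear_cmul[OF l] real_scaleR_def)
  qed
  have "((\<lambda>t. f (a + t *\<^sub>R (x - a))) has_vector_derivative ?g t (x - a)) (at t within {0..1})"
    if t: "t \<in> {0..1}" for t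
  proof -
    have "((\<lambda>t. a + t *\<^sub>R (x - a)) has_derivative (\<lambda>s. s *\<^sub>R (x - a))) (at t within {0..1})"
      by (auto intro!: derivative_eq_intros)
    note has_derivative_compose[OF this smooth_on_frechet(1)[OF f seg[OF t]]]
    moreover have "linear (?g t)"
      using smooth_on_frechet(1)[OF f seg[OF t]] has_derivative_linear by blast
    ultimately show ?thesis
      by (simp add: has_vector_derivative_def linear_cmul)
  qed
  then have "((\<lambda>t. ?g t (x - a)) has_integral (f (a + 1 *\<^sub>R (x - a)) - f (a + 0 *\<^sub>R (x - a)))) {0..1}"
    by (rule fundamental_theorem_of_calculus[rotated]) auto
  then have "((\<lambda>t. \<Sum>b\<in>Basis. ((x - a) \<bullet> b) * ?g t b) has_integral (f x - f a)) {0..1}"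
    by (subst has_integral_cong[OF rep[symmetric]]) auto
  then have "f x - f a = integral {0..1} (\<lambda>t. \<Sum>b\<in>Basis. ((x - a) \<bullet> b) * ?g t b)"
    by (simp add: integral_unique)
  also have "\<dots> = (\<Sum>b\<in>Basis. ((x - a) \<bullet> b) * ?h b x)"
  proof -
    have "(\<lambda>t. ?g t b) integrable_on {0..1}" for b
      by (intro integrable_continuous_interval continuous_intros
          continuous_on_compose2[OF smooth_on_imp_continuous_on[OF smooth_on_frechet(2)[OF f]]])
        (use seg in \<open>auto simp del: mem_ball\<close>)
    then have "(\<lambda>t. c * ?g t b) integrable_on {0..1}" for b c
      by (rule integrable_on_mult_right)
    then show ?thesis
      by (subst integral_sum) auto
  qed
  finally show "f x = f a + (\<Sum>b\<in>Basis. ((x - a) \<bullet> b) * ?h b x)" by simp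
qed

subsection \<open>Bump functions\<close>

text \<open>For \<open>n = 0\<close> this is the classical function exp(-1/x), flat at 0. The factor
  \<open>inverse x ^ n\<close> makes the family closed under differentiation up to linear
  combinations.\<close>

definition flat_fun :: "nat \<Rightarrow> real \<Rightarrow> real" where
  "flat_fun n x = (if x > 0 then inverse x ^ n * exp (- inverse x) else 0)"

lemma flat_fun_tendsto_0: "(flat_fun n \<longlongrightarrow> 0) (at 0)"
proof -
  have "((\<lambda>x::real. x ^ n / exp x) \<longlongrightarrow> 0) at_top" by (rule tendsto_power_div_exp_0)
  then have "((\<lambda>x::real. inverse x ^ n / exp (inverse x)) \<longlongrightarrow> 0) (at_right 0)"
    by (rule filterlim_compose[OF _ filterlim_inverse_at_top_right])
  then have "(flat_fun n \<longlongrightarrow> 0) (at_right 0)"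
    by (rule Lim_transform_eventually)
      (auto simp: eventually_at_filter flat_fun_def exp_minus divide_inverse)
  moreover have "(flat_fun n \<longlongrightarrow> 0) (at_left 0)"
    by (rule tendsto_eventually) (auto simp: eventually_at_filter flat_fun_def)
  ultimately show ?thesis by (simp add: filterlim_split_at)
qed

lemma flat_fun_has_derivative:
  "(flat_fun n has_real_derivative (flat_fun (n + 2) x - n * flat_fun (n + 1) x)) (at x)"
proof -
  consider "x > 0" | "x < 0" | "x = 0" by linarith
  then show ?thesis
  proof cases
    case 1
    let ?y = "inverse x"
    have "((\<lambda>x. inverse x ^ n * exp (- inverse x)) has_real_derivative
        n * ?y ^ (n - 1) * - (?y * ?y) * exp (- ?y) + ?y ^ n * (exp (- ?y) * (?y * ?y))) (at x)"
      using 1 by (auto intro!: derivative_eq_intros)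
    \<comment> \<open>The truncated subtraction in the exponent does no harm: for
      \<open>n = 0\<close> the factor \<open>n\<close> removes the term.\<close>
    also have "n * ?y ^ (n - 1) * - (?y * ?y) * exp (- ?y) + ?y ^ n * (exp (- ?y) * (?y * ?y)) =
        flat_fun (n + 2) x - n * flat_fun (n + 1) x"
      using 1 by (cases n) (simp_all add: flat_fun_def algebra_simps)
    finally have "((\<lambda>x. inverse x ^ n * exp (- inverse x)) has_real_derivative
        (flat_fun (n + 2) x - n * flat_fun (n + 1) x)) (at x)" .
    then show ?thesis
      by (rule has_field_derivative_transform_within_open[where S = "{0<..}"])
        (use 1 in \<open>auto simp: flat_fun_def\<close>)
  next
    case 2
    have "((\<lambda>x. 0) has_real_derivative (flat_fun (n + 2) x - n * flat_fun (n + 1) x)) (at x)"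
      using 2 by (simp add: flat_fun_def)
    then show ?thesis
      by (rule has_field_derivative_transform_within_open[where S = "{..<0}"])
        (use 2 in \<open>auto simp: flat_fun_def\<close>)
  next
    case 3
    \<comment> \<open>The difference quotient of \<open>flat_fun n\<close> at 0 is
      \<open>flat_fun (Suc n)\<close>, so the limit is an instance of
      \<open>flat_fun_tendsto_0\<close>.\<close>
    have "((\<lambda>h. (flat_fun n (0 + h) - flat_fun n 0) / h) \<longlongrightarrow> 0) (at 0)"
      by (rule Lim_transform_eventually[OF flat_fun_tendsto_0[of "Suc n"]])
        (auto simp: eventually_at_filter flat_fun_def divide_inverse mult_ac)
    then show ?thesis using 3 by (simp add: DERIV_def flat_fun_def)
  qed
qed

lemma smooth_on_flat_fun: "smooth_on UNIV (flat_fun n)"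
proof -
  have "Ck_on k UNIV (flat_fun n)" for k
  proof (induction k arbitrary: n)
    case 0
    show ?case
      using flat_fun_has_derivative by (auto intro!: continuous_at_imp_continuous_on DERIV_isCont)
  next
    case (Suc k)
    show ?case
    proof (rule Ck_on_SucI[where f' = "\<lambda>x v. (flat_fun (n + 2) x - n * flat_fun (n + 1) x) * v"])
      show "(flat_fun n has_derivative (*) (flat_fun (n + 2) x - n * flat_fun (n + 1) x)) (at x)" for x
        using flat_fun_has_derivative[of n x] by (simp add: has_field_derivative_def)
      fix v :: real
      have "Ck_on k UNIV (\<lambda>x. (flat_fun (n + 2) x + (- real n) * flat_fun (n + 1) x) * v)"
        by (intro Ck_on_mult Ck_on_add Ck_on_const Suc.IH open_UNIV)
      then show "Ck_on k UNIV (\<lambda>x. (flat_fun (n + 2) x - n * flat_fun (n + 1) x) * v)"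
        by simp
    qed simp
  qed
  then show ?thesis by (simp add: smooth_on_def)
qed

lemma bump_exists:
  fixes a :: "'a::euclidean_space"
  assumes "r > 0"
  shows "\<exists>\<kappa>::'a \<Rightarrow> real. smooth_on UNIV \<kappa> \<and> (\<forall>x\<in>ball a r. \<kappa> x = 1) \<and> (\<forall>x. x \<notin> cball a (2 * r) \<longrightarrow> \<kappa> x = 0)"
proof (intro exI conjI)
  \<comment> \<open>The squared distance to \<open>a\<close>, as a polynomial in the coordinates.
    \<open>?f\<close> is positive exactly inside radius \<open>2 * r\<close>, \<open>?g\<close>
    exactly outside the closed ball of radius \<open>r\<close>.\<close>
  let ?s = "\<lambda>x::'a. \<Sum>b\<in>Basis. ((x - a) \<bullet> b) * ((x - a) \<bullet> b)"
  let ?f = "\<lambda>x. flat_fun 0 (4 * r\<^sup>2 - ?s x)"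
  let ?g = "\<lambda>x. flat_fun 0 (?s x - r\<^sup>2)"
  let ?\<kappa> = "\<lambda>x. ?f x / (?f x + ?g x)"
  have s: "?s x = (dist a x)\<^sup>2" for x
    by (simp add: euclidean_inner[symmetric] dot_square_norm dist_norm norm_minus_commute)
  have sub: "smooth_on UNIV (\<lambda>x. (x - a) \<bullet> b)" for b
    using smooth_on_add[OF open_UNIV smooth_on_bounded_linear[OF open_UNIV bounded_linear_inner_left smooth_on_ident]
        smooth_on_const, of b "- (a \<bullet> b)"]
    by (simp add: inner_diff_left)
  have ss: "smooth_on UNIV ?s"
    by (intro smooth_on_sum smooth_on_mult sub open_UNIV)
  have "smooth_on UNIV (\<lambda>x. 4 * r\<^sup>2 + (-1) * ?s x)" "smooth_on UNIV (\<lambda>x. ?s x + - r\<^sup>2)"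
    by (intro smooth_on_add smooth_on_mult smooth_on_const ss open_UNIV)+
  then have sf: "smooth_on UNIV ?f" "smooth_on UNIV ?g"
    using smooth_on_compose[OF open_UNIV open_UNIV subset_UNIV _ smooth_on_flat_fun,
        of "\<lambda>x. 4 * r\<^sup>2 + (-1) * ?s x" 0]
      smooth_on_compose[OF open_UNIV open_UNIV subset_UNIV _ smooth_on_flat_fun,
        of "\<lambda>x. ?s x + - r\<^sup>2" 0]
    by (simp_all only: mult_minus1 diff_conv_add_uminus)
  show "smooth_on UNIV ?\<kappa>"
  proof (intro smooth_on_divide smooth_on_add sf open_UNIV)
    fix x
    \<comment> \<open>The arguments of the two flat functions add up to
      \<open>3 * r\<^sup>2 > 0\<close>, so at least one of them is positive.\<close>
    have "?f x \<ge> 0" "?g x \<ge> 0" "?f x > 0 \<or> ?g x > 0"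
      using assms by (auto simp: flat_fun_def) (smt (verit) zero_less_power)
    then show "?f x + ?g x \<noteq> 0" by linarith
  qed
  show "\<forall>x\<in>ball a r. ?\<kappa> x = 1"
  proof
    fix x assume "x \<in> ball a r"
    then have "(dist a x)\<^sup>2 < r\<^sup>2" by (auto intro: power_strict_mono)
    moreover have "0 < r\<^sup>2" using assms by simp
    ultimately have "?s x < r\<^sup>2" "?s x < 4 * r\<^sup>2" unfolding s by linarith+
    then have "?g x = 0" "?f x > 0" by (simp_all add: flat_fun_def)
    then show "?\<kappa> x = 1" by simp
  qed
  show "\<forall>x. x \<notin> cball a (2 * r) \<longrightarrow> ?\<kappa> x = 0"
  proof (intro allI impI)
    fix x assume "x \<notin> cball a (2 * r)"
    then have "(2 * r)\<^sup>2 < (dist a x)\<^sup>2" using assms by (intro power_strict_mono) auto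
    then show "?\<kappa> x = 0" by (simp add: flat_fun_def s power_mult_distrib)
  qed
qed

section \<open>Smooth functions, derivations and vector fields on manifolds\<close>

lemma sum_fun_apply: "(\<Sum>i\<in>I. f i) x = (\<Sum>i\<in>I. f i x)"
  by (induction I rule: infinite_finite_induct) auto

text \<open>The values of \<open>g\<close> outside \<open>T\<close> do not matter: the open sets
  \<open>T\<close> and \<open>- K\<close> cover the space, and on the second one the product is
  0.\<close>

lemma smooth_on_cutoff_mult:
  fixes g :: "'a::euclidean_space \<Rightarrow> real"
  assumes "smooth_on T g" "open T" "compact K" "K \<subseteq> T" "smooth_on UNIV \<kappa>" "\<And>x. x \<notin> K \<Longrightarrow> \<kappa> x = 0"
  shows "smooth_on UNIV (\<lambda>x. \<kappa> x * g x)"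
proof (rule smooth_on_Union)
  fix x
  show "\<exists>W. open W \<and> x \<in> W \<and> smooth_on W (\<lambda>x. \<kappa> x * g x)"
  proof (cases "x \<in> T")
    case True
    then show ?thesis
      using smooth_on_mult[OF assms(2) smooth_on_subset[OF assms(5)] assms(1)] assms(2) by auto
  next
    case False
    have o: "open (- K)" using assms(3) by (simp add: compact_imp_closed open_Compl)
    have "smooth_on (- K) (\<lambda>x. \<kappa> x * g x)"
      by (rule smooth_on_cong[OF o _ smooth_on_const[of _ 0]]) (use assms(6) in auto)
    then show ?thesis using o False assms(4) by blast
  qed
qed

lemma compact_bump_exists:
  fixes a :: "'a::euclidean_space"
  assumes "open T" "a \<in> T"
  obtains \<kappa> :: "'a \<Rightarrow> real" and K r where "r > 0" "ball a r \<subseteq> T" "smooth_on UNIV \<kappa>"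
    "\<And>x. x \<in> ball a r \<Longrightarrow> \<kappa> x = 1" "compact K" "K \<subseteq> T" "\<And>x. x \<notin> K \<Longrightarrow> \<kappa> x = 0"
proof -
  obtain s where s: "s > 0" "cball a s \<subseteq> T" using assms open_contains_cball by blast
  \<comment> \<open>Half the radius, because the bump for radius \<open>r\<close> is supported in
    the closed ball of radius \<open>2 * r\<close>.\<close>
  have "s / 2 > 0" using s by simp
  from bump_exists[OF this, of a] obtain \<kappa> :: "'a \<Rightarrow> real" where \<kappa>: "smooth_on UNIV \<kappa>" "\<And>x. x \<in> ball a (s/2) \<Longrightarrow> \<kappa> x = 1"
    "\<And>x. x \<notin> cball a s \<Longrightarrow> \<kappa> x = 0" by auto
  have "ball a (s/2) \<subseteq> T" using s by (auto simp: subset_iff)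
  from that[OF \<open>s / 2 > 0\<close> this \<kappa>(1) \<kappa>(2) compact_cball s(2) \<kappa>(3)] show ?thesis .
qed

locale smooth_manifold =
  fixes A :: "('m::{t2_space,second_countable_topology}, 'a::euclidean_space) atlas"
  assumes atlas: "smooth_atlas A"
begin

section \<open>Charts and the algebra of smooth functions\<close>

lemma chart_ex: obtains U c where "(U, c) \<in> A" "p \<in> U"
proof -
  have "p \<in> (\<Union>(U, c)\<in>A. U)" using atlas by (simp add: smooth_atlas_def)
  then show ?thesis using that by auto
qed

lemma chartD:
  assumes "(U, c) \<in> A"
  shows "open U" "open (c ` U)" "homeomorphism U (c ` U) c (inv_into U c)"
  using atlas assms by (auto simp: smooth_atlas_def chart_def)

lemma chart_inv:
  assumes "(U, c) \<in> A"
  shows "q \<in> U \<Longrightarrow> inv_into U c (c q) = q" "y \<in> c ` U \<Longrightarrow> c (inv_into U c y) = y"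
    "y \<in> c ` U \<Longrightarrow> inv_into U c y \<in> U"
  using chartD(3)[OF assms] by (auto simp: homeomorphism_def inv_into_into)

lemma chart_open_image:
  assumes "(U, c) \<in> A" "open W"
  shows "open (c ` (U \<inter> W))"
  using homeomorphism_imp_open_map[OF chartD(3)[OF assms(1)], of "U \<inter> W"] chartD[OF assms(1)] assms(2)
  by (auto simp: openin_open_eq)

lemma chart_open_vimage:
  assumes "(U, c) \<in> A" "open T"
  shows "open {q \<in> U. c q \<in> T}"
proof -
  have "continuous_on U c" using chartD(3)[OF assms(1)] by (simp add: homeomorphism_def)
  then have "open (U \<inter> c -` T)"
    using chartD(1)[OF assms(1)] assms(2) continuous_on_open_vimage[of U c] by (auto simp: Int_commute)
  moreover have "U \<inter> c -` T = {q \<in> U. c q \<in> T}" by auto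
  ultimately show ?thesis by simp
qed

lemma transition_smooth:
  "(U, c) \<in> A \<Longrightarrow> (V, d) \<in> A \<Longrightarrow> smooth_on (c ` (U \<inter> V)) (d \<circ> inv_into U c)"
  using atlas unfolding smooth_atlas_def by fastforce

lemma smooth_funD: "smooth_fun A f \<Longrightarrow> (U, c) \<in> A \<Longrightarrow> smooth_on (c ` U) (\<lambda>y. f (inv_into U c y))"
  unfolding smooth_fun_def by (fastforce simp: o_def)

lemma smooth_funI:
  "(\<And>U c. (U, c) \<in> A \<Longrightarrow> smooth_on (c ` U) (\<lambda>y. f (inv_into U c y))) \<Longrightarrow> smooth_fun A f"
  unfolding smooth_fun_def by (auto simp: o_def)

lemma smooth_funI_local:
  assumes "\<And>U c q. (U, c) \<in> A \<Longrightarrow> q \<in> U \<Longrightarrow> \<exists>W. open W \<and> q \<in> W \<and>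
    smooth_on (c ` (U \<inter> W)) (\<lambda>y. f (inv_into U c y))"
  shows "smooth_fun A f"
proof (rule smooth_funI, rule smooth_on_Union)
  fix U c y assume Uc: "(U, c) \<in> A" and "y \<in> c ` U"
  then obtain q where q: "q \<in> U" "y = c q" by auto
  from assms[OF Uc q(1)] obtain W where W: "open W" "q \<in> W"
    "smooth_on (c ` (U \<inter> W)) (\<lambda>y. f (inv_into U c y))" by blast
  then show "\<exists>T. open T \<and> y \<in> T \<and> smooth_on T (\<lambda>y. f (inv_into U c y))"
    using chart_open_image[OF Uc W(1)] q by blast
qed

lemma smooth_fun_const: "smooth_fun A (\<lambda>q. k)"
  by (rule smooth_funI) (rule smooth_on_const)

lemma smooth_fun_add: "smooth_fun A f \<Longrightarrow> smooth_fun A g \<Longrightarrow> smooth_fun A (\<lambda>q. f q + g q)"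
  by (rule smooth_funI) (auto intro: smooth_on_add smooth_funD chartD)

lemma smooth_fun_mult: "smooth_fun A f \<Longrightarrow> smooth_fun A g \<Longrightarrow> smooth_fun A (\<lambda>q. f q * g q)"
  by (rule smooth_funI) (auto intro: smooth_on_mult smooth_funD chartD)

lemma smooth_fun_cmult: "smooth_fun A g \<Longrightarrow> smooth_fun A (\<lambda>q. k * g q)"
  by (rule smooth_fun_mult[OF smooth_fun_const])

lemma smooth_fun_diff:
  assumes "smooth_fun A f" "smooth_fun A g"
  shows "smooth_fun A (\<lambda>q. f q - g q)"
  using smooth_fun_add[OF assms(1) smooth_fun_cmult[OF assms(2), of "-1"]] by simp

lemma smooth_fun_sum:
  assumes "\<And>i. i \<in> I \<Longrightarrow> smooth_fun A (f i)"
  shows "smooth_fun A (\<lambda>q. \<Sum>i\<in>I. f i q)"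
  using assms by (induction I rule: infinite_finite_induct) (auto intro: smooth_fun_const smooth_fun_add)

lemma smooth_fun_prod:
  assumes "\<And>i. i \<in> I \<Longrightarrow> smooth_fun A (f i)"
  shows "smooth_fun A (\<lambda>q. \<Prod>i\<in>I. f i q)"
  using assms by (induction I rule: infinite_finite_induct) (auto intro: smooth_fun_const smooth_fun_mult)

text \<open>Numerator and denominator are globally smooth but chosen anew for each \<open>p\<close>.
  This suits functions computed from a frame that is nondegenerate only near
  \<open>p\<close>.\<close>

lemma smooth_fun_local_quotient:
  assumes "\<And>p. \<exists>W n d. open W \<and> p \<in> W \<and> smooth_fun A n \<and> smooth_fun A d \<and>
    (\<forall>q\<in>W. d q \<noteq> 0 \<and> f q = n q / d q)"
  shows "smooth_fun A f"
proof (rule smooth_funI_local)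
  fix U c p assume Uc: "(U, c) \<in> A" and p: "p \<in> U"
  from assms[of p] obtain W n d where W: "open W" "p \<in> W" "smooth_fun A n" "smooth_fun A d"
    "\<And>q. q \<in> W \<Longrightarrow> d q \<noteq> 0 \<and> f q = n q / d q" by blast
  have o: "open (c ` (U \<inter> W))" by (rule chart_open_image[OF Uc W(1)])
  have e: "d (inv_into U c y) \<noteq> 0 \<and> f (inv_into U c y) = n (inv_into U c y) / d (inv_into U c y)"
    if "y \<in> c ` (U \<inter> W)" for y
    using that W(5) chart_inv(1)[OF Uc] by auto
  have "smooth_on (c ` (U \<inter> W)) (\<lambda>y. n (inv_into U c y) / d (inv_into U c y))"
    by (rule smooth_on_divide[OF o])
      (use e in \<open>auto intro: smooth_on_subset[OF smooth_funD[OF _ Uc]] W\<close>)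
  then have "smooth_on (c ` (U \<inter> W)) (\<lambda>y. f (inv_into U c y))"
    by (rule smooth_on_cong[OF o, rotated]) (use e in auto)
  then show "\<exists>W. open W \<and> p \<in> W \<and> smooth_on (c ` (U \<inter> W)) (\<lambda>y. f (inv_into U c y))"
    using W by blast
qed

section \<open>Continuity, extension by zero and bump functions on a manifold\<close>

lemma smooth_fun_continuous:
  assumes "smooth_fun A f"
  shows "continuous_on UNIV f"
proof -
  have "isCont f p" for p
  proof -
    obtain U c where Uc: "(U, c) \<in> A" "p \<in> U" using chart_ex .
    have "continuous_on U (\<lambda>q. f (inv_into U c (c q)))"
      by (rule continuous_on_compose2[OF smooth_on_imp_continuous_on[OF smooth_funD[OF assms Uc(1)]]])
        (use chartD(3)[OF Uc(1)] in \<open>auto simp: homeomorphism_def\<close>)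
    then have "continuous_on U f"
      by (simp add: chart_inv(1)[OF Uc(1)] cong: continuous_on_cong)
    then show ?thesis using continuous_on_eq_continuous_at chartD(1)[OF Uc(1)] Uc(2) by blast
  qed
  then show ?thesis by (simp add: continuous_at_imp_continuous_on)
qed

lemma smooth_fun_nonzero_nbhd:
  assumes "smooth_fun A f" "f p \<noteq> 0"
  obtains W where "open W" "p \<in> W" "\<And>q. q \<in> W \<Longrightarrow> f q \<noteq> 0"
proof -
  have "open (f -` (- {0}))"
    using smooth_fun_continuous[OF assms(1)] by (intro open_vimage) auto
  then show ?thesis using that[of "f -` (- {0})"] assms(2) by auto
qed

text \<open>In a Hausdorff space the compact preimage of \<open>K\<close> is closed. On its open
  complement the extended function is 0, and on \<open>U\<close> it is read through a transition
  map.\<close>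

lemma smooth_fun_extend_zero:
  assumes Uc: "(U, c) \<in> A" and g: "smooth_on (c ` U) g" and K: "compact K" "K \<subseteq> c ` U"
    and z: "\<And>y. y \<notin> K \<Longrightarrow> g y = 0"
  shows "smooth_fun A (\<lambda>q. if q \<in> U then g (c q) else 0)" (is "smooth_fun A ?f")
proof (rule smooth_funI_local)
  fix V d q assume Vd: "(V, d) \<in> A" and q: "q \<in> V"
  show "\<exists>W. open W \<and> q \<in> W \<and> smooth_on (d ` (V \<inter> W)) (\<lambda>y. ?f (inv_into V d y))"
  proof (cases "q \<in> U")
    case True
    have o: "open (d ` (V \<inter> U))" by (rule chart_open_image[OF Vd chartD(1)[OF Uc]])
    have "smooth_on (d ` (V \<inter> U)) (\<lambda>y. g ((c \<circ> inv_into V d) y))"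
      by (rule smooth_on_compose[OF o chartD(2)[OF Uc] _ transition_smooth[OF Vd Uc] g])
        (auto simp: chart_inv[OF Vd])
    then have "smooth_on (d ` (V \<inter> U)) (\<lambda>y. ?f (inv_into V d y))"
      by (rule smooth_on_cong[OF o, rotated]) (auto simp: chart_inv[OF Vd])
    then show ?thesis using True chartD(1)[OF Uc] by blast
  next
    case False
    have "compact (inv_into U c ` K)"
      using chartD(3)[OF Uc] K
      by (intro compact_continuous_image) (auto simp: homeomorphism_def intro: continuous_on_subset)
    then have o: "open (- inv_into U c ` K)" by (simp add: compact_imp_closed open_Compl)
    have sub: "inv_into U c ` K \<subseteq> U" using K chart_inv(3)[OF Uc] by auto
    have "g (c r) = 0" if "r \<notin> inv_into U c ` K" "r \<in> U" for r
      using that chart_inv(1)[OF Uc that(2)] by (intro z) (metis image_eqI)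
    then have "smooth_on (d ` (V \<inter> - inv_into U c ` K)) (\<lambda>y. ?f (inv_into V d y))"
      by (intro smooth_on_cong[OF chart_open_image[OF Vd o] _ smooth_on_const[of _ 0]])
        (auto simp: chart_inv[OF Vd])
    then show ?thesis using o False sub by blast
  qed
qed

text \<open>Turns statements near a point into statements about globally smooth functions, on which
  derivations act.\<close>

lemma manifold_bump:
  assumes "open W" "p \<in> W"
  obtains \<kappa> where "smooth_fun A \<kappa>" "\<kappa> p = 1" "\<And>q. q \<notin> W \<Longrightarrow> \<kappa> q = 0"
proof -
  obtain U c where Uc: "(U, c) \<in> A" "p \<in> U" using chart_ex .
  have "open (c ` (U \<inter> W))" "c p \<in> c ` (U \<inter> W)"
    using chart_open_image[OF Uc(1) assms(1)] Uc(2) assms(2) by auto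
  then obtain \<kappa> :: "'a \<Rightarrow> real" and K r where \<kappa>: "r > 0" "ball (c p) r \<subseteq> c ` (U \<inter> W)" "smooth_on UNIV \<kappa>"
    "\<And>x. x \<in> ball (c p) r \<Longrightarrow> \<kappa> x = 1" "compact K" "K \<subseteq> c ` (U \<inter> W)" "\<And>x. x \<notin> K \<Longrightarrow> \<kappa> x = 0"
    using compact_bump_exists by metis
  let ?k = "\<lambda>q. if q \<in> U then \<kappa> (c q) else 0"
  have "smooth_fun A ?k"
    by (rule smooth_fun_extend_zero[OF Uc(1) smooth_on_subset[OF \<kappa>(3)] \<kappa>(5)]) (use \<kappa> in auto)
  moreover have "?k p = 1" using \<kappa>(1,4) Uc(2) by simp
  moreover have "?k q = 0" if "q \<notin> W" for q
  proof -
    have "c q \<notin> K" if "q \<in> U"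
    proof
      assume "c q \<in> K"
      then obtain q' where "q' \<in> U \<inter> W" "c q = c q'" using \<kappa>(6) by auto
      then show False using chart_inv(1)[OF Uc(1)] \<open>q \<in> U\<close> \<open>q \<notin> W\<close> by (metis IntD1 IntD2)
    qed
    then show ?thesis using \<kappa>(7) by auto
  qed
  ultimately show ?thesis using that by blast
qed

subsection \<open>Derivations\<close>

abbreviation "T p \<equiv> tangent_space A p"

lemma tangentI:
  assumes "\<And>f. \<not> smooth_fun A f \<Longrightarrow> v f = 0"
    "\<And>f h a b. smooth_fun A f \<Longrightarrow> smooth_fun A h \<Longrightarrow> v (\<lambda>q. a * f q + b * h q) = a * v f + b * v h"
    "\<And>f h. smooth_fun A f \<Longrightarrow> smooth_fun A h \<Longrightarrow> v (\<lambda>q. f q * h q) = f p * v h + h p * v f"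
  shows "v \<in> T p"
  using assms by (simp add: tangent_space_def)

lemma tangent_nonsmooth: "v \<in> T p \<Longrightarrow> \<not> smooth_fun A f \<Longrightarrow> v f = 0"
  by (simp add: tangent_space_def)

lemma tangent_lincomb: "v \<in> T p \<Longrightarrow> smooth_fun A f \<Longrightarrow> smooth_fun A h \<Longrightarrow>
    v (\<lambda>q. a * f q + b * h q) = a * v f + b * v h"
  by (simp add: tangent_space_def)

lemma tangent_mult: "v \<in> T p \<Longrightarrow> smooth_fun A f \<Longrightarrow> smooth_fun A h \<Longrightarrow>
    v (\<lambda>q. f q * h q) = f p * v h + h p * v f"
  by (simp add: tangent_space_def)

lemma tangent_add: "v \<in> T p \<Longrightarrow> smooth_fun A f \<Longrightarrow> smooth_fun A h \<Longrightarrow> v (\<lambda>q. f q + h q) = v f + v h"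
  using tangent_lincomb[of v p f h 1 1] by simp

lemma tangent_diff: "v \<in> T p \<Longrightarrow> smooth_fun A f \<Longrightarrow> smooth_fun A h \<Longrightarrow> v (\<lambda>q. f q - h q) = v f - v h"
  using tangent_lincomb[of v p f h 1 "-1"] by simp

text \<open>The product rule for \<open>1 * 1\<close> gives \<open>v 1 = 2 * v 1\<close>.\<close>

lemma tangent_const: assumes "v \<in> T p" shows "v (\<lambda>q. k) = 0"
proof -
  have "v (\<lambda>q. 1 * 1) = 1 * v (\<lambda>q. 1) + 1 * v (\<lambda>q. 1)"
    by (rule tangent_mult[OF assms smooth_fun_const smooth_fun_const])
  then have 0: "v (\<lambda>q. 1) = 0" by simp
  show ?thesis
    using tangent_lincomb[OF assms smooth_fun_const[of 1] smooth_fun_const[of 1], of k 0] 0 by simp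
qed

lemma tangent_sum:
  assumes "v \<in> T p" "\<And>i. i \<in> I \<Longrightarrow> smooth_fun A (f i)"
  shows "v (\<lambda>q. \<Sum>i\<in>I. f i q) = (\<Sum>i\<in>I. v (f i))"
  using assms(2)
proof (induction I rule: infinite_finite_induct)
  case (insert i I)
  have "smooth_fun A (f i)" "smooth_fun A (\<lambda>q. \<Sum>i\<in>I. f i q)"
    using insert.prems by (auto intro: smooth_fun_sum)
  then show ?case using insert by (simp add: tangent_add[OF assms(1)])
qed (simp_all add: tangent_const[OF assms(1)])

text \<open>For a bump \<open>\<kappa>\<close> vanishing outside \<open>W\<close>, the function
  \<open>\<kappa> * (f - h)\<close> is identically 0, and the product rule at \<open>p\<close>
  leaves \<open>v (f - h) = 0\<close>.\<close>

lemma tangent_local: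
  assumes v: "v \<in> T p" and "smooth_fun A f" "smooth_fun A h" "open W" "p \<in> W" "\<And>q. q \<in> W \<Longrightarrow> f q = h q"
  shows "v f = v h"
proof -
  obtain \<kappa> where \<kappa>: "smooth_fun A \<kappa>" "\<kappa> p = 1" "\<And>q. q \<notin> W \<Longrightarrow> \<kappa> q = 0"
    using manifold_bump[OF assms(4,5)] by blast
  have fh: "smooth_fun A (\<lambda>q. f q - h q)" by (intro smooth_fun_diff assms)
  have "(\<lambda>q. \<kappa> q * (f q - h q)) = (\<lambda>q. 0)" using assms(6) \<kappa>(3) by fastforce
  then have "v (\<lambda>q. \<kappa> q * (f q - h q)) = 0" using tangent_const[OF v] by simp
  then show ?thesis
    using tangent_mult[OF v \<kappa>(1) fh] \<kappa>(2) assms(5,6) tangent_diff[OF v assms(2,3)] by simp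
qed

lemma tangent_subspace: "subspace (T p)"
  unfolding subspace_def
proof (intro conjI ballI allI)
  show "0 \<in> T p" by (rule tangentI) auto
next
  fix u v assume uv: "u \<in> T p" "v \<in> T p"
  show "u + v \<in> T p"
    by (rule tangentI)
      (auto simp: tangent_nonsmooth[OF uv(1)] tangent_nonsmooth[OF uv(2)] tangent_lincomb[OF uv(1)]
        tangent_lincomb[OF uv(2)] tangent_mult[OF uv(1)] tangent_mult[OF uv(2)] algebra_simps)
next
  fix v k assume v: "v \<in> T p"
  show "k *\<^sub>R v \<in> T p"
    by (rule tangentI)
      (auto simp: tangent_nonsmooth[OF v] tangent_lincomb[OF v] tangent_mult[OF v] algebra_simps)
qed

subsection \<open>Vector fields\<close>

lemma vector_fieldD: "vector_field A X \<Longrightarrow> X p \<in> T p"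
  "vector_field A X \<Longrightarrow> smooth_fun A f \<Longrightarrow> smooth_fun A (\<lambda>p. X p f)"
  by (auto simp: vector_field_def)

lemma vector_field_zero: "vector_field A 0"
  using subspace_0[OF tangent_subspace] by (auto simp: vector_field_def zero_fun_def intro: smooth_fun_const)

lemma vector_field_add: "vector_field A X \<Longrightarrow> vector_field A Y \<Longrightarrow> vector_field A (\<lambda>p. X p + Y p)"
  using subspace_add[OF tangent_subspace] by (auto simp: vector_field_def intro: smooth_fun_add)

lemma vector_field_scale: "smooth_fun A f \<Longrightarrow> vector_field A X \<Longrightarrow> vector_field A (\<lambda>p. f p *\<^sub>R X p)"
  using subspace_scale[OF tangent_subspace] by (auto simp: vector_field_def intro: smooth_fun_mult)

lemma vector_field_diff:
  assumes "vector_field A X" "vector_field A Y"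
  shows "vector_field A (\<lambda>p. X p - Y p)"
  using vector_field_add[OF assms(1) vector_field_scale[OF smooth_fun_const[of "-1"] assms(2)]] by simp

lemma vector_field_sum:
  assumes "\<And>i. i \<in> I \<Longrightarrow> vector_field A (X i)"
  shows "vector_field A (\<lambda>p. \<Sum>i\<in>I. X i p)"
  using assms
  by (induction I rule: infinite_finite_induct)
    (use vector_field_zero in \<open>auto intro: vector_field_add simp: zero_fun_def\<close>)

text \<open>\<open>x\<close> are chart coordinates and \<open>E\<close> partial derivatives, cut off
  by a bump function so that they live on the whole manifold. That the \<open>E i\<close> span all
  derivations comes from Hadamard's lemma.\<close>

lemma local_frame:
  obtains W :: "'m set" and x E where "open W" "p \<in> W"
    "\<And>i. i \<in> Basis \<Longrightarrow> smooth_fun A (x i)" "\<And>i. i \<in> Basis \<Longrightarrow> vector_field A (E i)"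
    "\<And>q i j. q \<in> W \<Longrightarrow> i \<in> Basis \<Longrightarrow> j \<in> Basis \<Longrightarrow> E i q (x j) = (if i = j then 1 else 0)"
    "\<And>q v. q \<in> W \<Longrightarrow> v \<in> T q \<Longrightarrow> v = (\<Sum>i\<in>(Basis :: 'a set). v (x i) *\<^sub>R E i q)"
proof -
  obtain U c where Uc: "(U, c) \<in> A" "p \<in> U" using chart_ex .
  let ?a = "c p"
  have o: "open (c ` U)" and a: "?a \<in> c ` U" using chartD(2)[OF Uc(1)] Uc(2) by auto
  obtain \<kappa> :: "'a \<Rightarrow> real" and K r where \<kappa>: "r > 0" "ball ?a r \<subseteq> c ` U" "smooth_on UNIV \<kappa>"
    "\<And>x. x \<in> ball ?a r \<Longrightarrow> \<kappa> x = 1" "compact K" "K \<subseteq> c ` U" "\<And>x. x \<notin> K \<Longrightarrow> \<kappa> x = 0"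
    using compact_bump_exists[OF o a] by metis
  define W where "W = {q \<in> U. c q \<in> ball ?a r}"
  define x where "x = (\<lambda>i q. if q \<in> U then \<kappa> (c q) * (c q \<bullet> i) else 0)"
  let ?D = "\<lambda>f y. frechet_derivative (\<lambda>y. f (inv_into U c y)) (at y)"
  \<comment> \<open>The value 0 on non-smooth \<open>f\<close> is what membership in
    \<open>tangent_space\<close> demands.\<close>
  define E where "E = (\<lambda>i q f. if smooth_fun A f \<and> q \<in> U then \<kappa> (c q) * ?D f (c q) i else 0)"
  have W: "open W" "p \<in> W"
    using chart_open_vimage[OF Uc(1) open_ball] Uc(2) \<kappa>(1) by (auto simp: W_def)
  have sx: "smooth_fun A (x i)" for i
    unfolding x_def
    by (rule smooth_fun_extend_zero[OF Uc(1) smooth_on_mult[OF o smooth_on_subset[OF \<kappa>(3)]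
            smooth_on_bounded_linear[OF o bounded_linear_inner_left smooth_on_ident[OF o]]] \<kappa>(5,6)])
      (use \<kappa>(7) in auto)
  have der: "((\<lambda>y. f (inv_into U c y)) has_derivative ?D f (c q)) (at (c q))"
    if "smooth_fun A f" "q \<in> U" for f q
    using smooth_on_frechet(1)[OF smooth_funD[OF that(1) Uc(1)], of "c q"] that(2) by auto
  have E_T: "E i q \<in> T q" for i q
  proof (cases "q \<in> U")
    case True
    show ?thesis
    proof (rule tangentI)
      fix f h k l assume s: "smooth_fun A f" "smooth_fun A h"
      have "((\<lambda>y. k * f (inv_into U c y) + l * h (inv_into U c y)) has_derivative
          (\<lambda>u. k * ?D f (c q) u + l * ?D h (c q) u)) (at (c q))"
        by (intro has_derivative_add has_derivative_mult_right der s True)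
      from frechet_derivative_at[OF this, symmetric] show "E i q (\<lambda>q. k * f q + l * h q) = k * E i q f + l * E i q h"
        using s True by (simp add: E_def smooth_fun_add smooth_fun_cmult algebra_simps)
      have "((\<lambda>y. f (inv_into U c y) * h (inv_into U c y)) has_derivative
          (\<lambda>u. f (inv_into U c (c q)) * ?D h (c q) u + ?D f (c q) u * h (inv_into U c (c q)))) (at (c q))"
        by (intro has_derivative_mult der s True)
      from frechet_derivative_at[OF this, symmetric] show "E i q (\<lambda>q. f q * h q) = f q * E i q h + h q * E i q f"
        using s True chart_inv(1)[OF Uc(1) True]
        by (simp add: E_def smooth_fun_mult algebra_simps)
    qed (simp add: E_def)
  next
    case False
    then show ?thesis using subspace_0[OF tangent_subspace] by (simp add: E_def zero_fun_def)
  qed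
  have E_vf: "vector_field A (E i)" for i
    unfolding vector_field_def
  proof (intro conjI allI impI E_T)
    fix f assume f: "smooth_fun A f"
    have "smooth_fun A (\<lambda>q. if q \<in> U then \<kappa> (c q) * ?D f (c q) i else 0)"
      by (rule smooth_fun_extend_zero[OF Uc(1) smooth_on_mult[OF o smooth_on_subset[OF \<kappa>(3)]
              smooth_on_frechet(2)[OF smooth_funD[OF f Uc(1)]]] \<kappa>(5,6)])
        (use \<kappa>(7) in auto)
    then show "smooth_fun A (\<lambda>q. E i q f)" using f by (simp add: E_def)
  qed
  have Ex: "E i q (x j) = (if i = j then 1 else 0)" if "q \<in> W" "i \<in> Basis" "j \<in> Basis" for i j q
  proof -
    have q: "q \<in> U" "c q \<in> ball ?a r" using that(1) by (auto simp: W_def)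
    have "((\<lambda>y. y \<bullet> j) has_derivative (\<lambda>u. u \<bullet> j)) (at (c q))"
      by (auto intro!: derivative_eq_intros)
    then have "((\<lambda>y. x j (inv_into U c y)) has_derivative (\<lambda>u. u \<bullet> j)) (at (c q))"
    proof (rule has_derivative_transform_within_open[OF _ open_ball q(2)])
      fix y assume y: "y \<in> ball ?a r"
      then have "y \<in> c ` U" using \<kappa>(2) by blast
      then show "y \<bullet> j = x j (inv_into U c y)"
        using \<kappa>(4)[OF y] by (simp add: x_def chart_inv[OF Uc(1)])
    qed
    from frechet_derivative_at[OF this] have "?D (x j) (c q) i = i \<bullet> j" by (simp add: fun_eq_iff)
    then show ?thesis using that sx q \<kappa>(4)[OF q(2)] by (simp add: E_def inner_Basis)
  qed
  have span: "v = (\<Sum>i\<in>(Basis :: 'a set). v (x i) *\<^sub>R E i q)" if qW: "q \<in> W" and v: "v \<in> T q" for q v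
  proof (rule ext)
    fix f
    have q: "q \<in> U" "c q \<in> ball ?a r" using qW by (auto simp: W_def)
    show "v f = (\<Sum>i\<in>Basis. v (x i) *\<^sub>R E i q) f"
    proof (cases "smooth_fun A f")
      case False
      then show ?thesis using tangent_nonsmooth[OF v] by (simp add: sum_fun_apply E_def)
    next
      case f: True
      obtain s where s: "s > 0" "ball (c q) s \<subseteq> ball ?a r"
        using q(2) open_ball open_contains_ball by blast
      have "smooth_on (ball (c q) s) (\<lambda>y. f (inv_into U c y))"
        by (rule smooth_on_subset[OF smooth_funD[OF f Uc(1)]]) (use s \<kappa>(2) in blast)
      from hadamard[OF this s(1)] obtain h where
        h: "\<And>b. b \<in> Basis \<Longrightarrow> smooth_on (ball (c q) s) (h b)"
           "\<And>b. b \<in> Basis \<Longrightarrow> h b (c q) = ?D f (c q) b"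
           "\<And>y. y \<in> ball (c q) s \<Longrightarrow> f (inv_into U c y) = f (inv_into U c (c q)) + (\<Sum>b\<in>Basis. ((y - c q) \<bullet> b) * h b y)"
        by blast
      have qs: "c q \<in> ball (c q) s" using s(1) by simp
      obtain \<mu> :: "'a \<Rightarrow> real" and L t where \<mu>: "t > 0" "smooth_on UNIV \<mu>"
        "\<And>x. x \<in> ball (c q) t \<Longrightarrow> \<mu> x = 1" "compact L" "L \<subseteq> ball (c q) s" "\<And>x. x \<notin> L \<Longrightarrow> \<mu> x = 0"
        using compact_bump_exists[OF open_ball qs] by metis
      have LU: "L \<subseteq> c ` U" using \<mu>(5) s(2) \<kappa>(2) by blast
      \<comment> \<open>\<open>m\<close> is a second bump, supported in the ball around
        \<open>c q\<close> on which the Hadamard expansion holds; \<open>H b\<close> is the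
        coefficient \<open>h b\<close> cut off by it. All factors below are thus globally
        smooth.\<close>
      define m where "m = (\<lambda>q. if q \<in> U then \<mu> (c q) else 0)"
      define H where "H = (\<lambda>b q. if q \<in> U then \<mu> (c q) * h b (c q) else 0)"
      have m: "smooth_fun A m"
        unfolding m_def
        by (rule smooth_fun_extend_zero[OF Uc(1) smooth_on_subset[OF \<mu>(2)] \<mu>(4) LU]) (use \<mu> in auto)
      have H: "smooth_fun A (H b)" if "b \<in> Basis" for b
        unfolding H_def
        by (rule smooth_fun_extend_zero[OF Uc(1) smooth_on_subset[OF
              smooth_on_cutoff_mult[OF h(1)[OF that] open_ball \<mu>(4,5,2,6)]] \<mu>(4) LU]) (use \<mu> in auto)
      have mq: "m q = 1" "H b q = h b (c q)" for b
        using q(1) \<mu>(1) \<mu>(3)[of "c q"] by (auto simp: m_def H_def)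
      \<comment> \<open>One factor \<open>m\<close> goes to the coordinate increments, the other
        into \<open>H b\<close>. On the support of \<open>m\<close> the first bump is 1, so
        \<open>x b\<close> is the true coordinate there.\<close>
      have eq: "m q' * (m q' * (f q' - f q)) = (\<Sum>b\<in>Basis. (m q' * (x b q' - c q \<bullet> b)) * H b q')" for q'
      proof (cases "q' \<in> U \<and> c q' \<in> L")
        case True
        then have "c q' \<in> ball (c q) s" using \<mu>(5) by blast
        moreover from this have "\<kappa> (c q') = 1" using s(2) \<kappa>(4) by blast
        moreover have "inv_into U c (c q') = q'" "inv_into U c (c q) = q"
          using chart_inv(1)[OF Uc(1)] True q(1) by auto
        ultimately show ?thesis
          using h(3)[of "c q'"] True
          by (simp add: m_def H_def x_def sum_distrib_left inner_diff_left mult_ac)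
      next
        case False
        then have "m q' = 0" using \<mu>(6) by (auto simp: m_def)
        then show ?thesis by simp
      qed
      have s1: "smooth_fun A (\<lambda>q'. f q' - f q)" "smooth_fun A (\<lambda>q'. m q' * (f q' - f q))"
        by (intro smooth_fun_mult smooth_fun_diff f smooth_fun_const m)+
      have s2: "smooth_fun A (\<lambda>q'. x b q' - c q \<bullet> b)" "smooth_fun A (\<lambda>q'. m q' * (x b q' - c q \<bullet> b))" for b
        by (intro smooth_fun_mult smooth_fun_diff sx smooth_fun_const m)+
      have xq: "x b q = c q \<bullet> b" for b using q \<kappa>(4) by (simp add: x_def)
      have "v f = v (\<lambda>q'. m q' * (m q' * (f q' - f q)))"
        using mq(1) by (simp add: tangent_mult[OF v m s1(2)] tangent_mult[OF v m s1(1)]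
            tangent_diff[OF v f smooth_fun_const] tangent_const[OF v])
      also have "\<dots> = v (\<lambda>q'. \<Sum>b\<in>Basis. (m q' * (x b q' - c q \<bullet> b)) * H b q')" by (simp add: eq)
      also have "\<dots> = (\<Sum>b\<in>Basis. v (\<lambda>q'. (m q' * (x b q' - c q \<bullet> b)) * H b q'))"
        by (rule tangent_sum[OF v]) (intro smooth_fun_mult s2 H)
      \<comment> \<open>The increment vanishes at \<open>q\<close> and \<open>m q = 1\<close>, so
        the product rule keeps only \<open>H b q * v (x b)\<close>.\<close>
      also have "\<dots> = (\<Sum>b\<in>Basis. h b (c q) * v (x b))"
        by (intro sum.cong refl, simp add: tangent_mult[OF v s2(2) H] tangent_mult[OF v m s2(1)]
            mq xq tangent_diff[OF v sx smooth_fun_const] tangent_const[OF v])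
      also have "\<dots> = (\<Sum>i\<in>Basis. v (x i) *\<^sub>R E i q) f"
        using f q \<kappa>(4)[OF q(2)] by (auto simp: sum_fun_apply E_def h(2) intro!: sum.cong)
      finally show ?thesis .
    qed
  qed
  show ?thesis by (rule that[OF W sx E_vf Ex span])
qed

text \<open>The components of \<open>v\<close> in a local frame serve as constant coefficients of
  the field.\<close>

lemma vector_field_extension:
  assumes "v \<in> T p"
  obtains X where "vector_field A X" "X p = v"
proof (rule local_frame[of p])
  fix W :: "'m set" and x and E :: "'a \<Rightarrow> 'm vfield"
  assume p: "p \<in> W" and E: "\<And>i. i \<in> Basis \<Longrightarrow> vector_field A (E i)"
    and span: "\<And>q v. q \<in> W \<Longrightarrow> v \<in> T q \<Longrightarrow> v = (\<Sum>i\<in>(Basis :: 'a set). v (x i) *\<^sub>R E i q)"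
  have "vector_field A (\<lambda>q. \<Sum>i\<in>(Basis :: 'a set). v (x i) *\<^sub>R E i q)"
    by (intro vector_field_sum vector_field_scale smooth_fun_const E)
  from that[OF this] show thesis using span[OF p assms] by simp
qed

end

section \<open>Riemannian metrics and orthogonal frames\<close>

text \<open>Serves a Gram-Schmidt step without division: \<open>y\<close> is scaled by
  \<open>k\<close>, and the correction \<open>r\<close> lies in the old span.\<close>

lemma span_insert_scale_diff:
  fixes y :: "'v::real_vector"
  assumes "k \<noteq> 0" "r \<in> span B"
  shows "span (insert (k *\<^sub>R y - r) B) = span (insert y B)"
proof (intro subset_antisym span_minimal insert_subsetI subspace_span)
  have r: "r \<in> span (insert z B)" for z using assms(2) span_mono[of B "insert z B"] by auto
  show "k *\<^sub>R y - r \<in> span (insert y B)"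
    by (intro span_diff span_scale r span_base) simp
  have "(1 / k) *\<^sub>R (k *\<^sub>R y - r) + (1 / k) *\<^sub>R r \<in> span (insert (k *\<^sub>R y - r) B)"
    by (intro span_add span_scale r span_base) simp
  then show "y \<in> span (insert (k *\<^sub>R y - r) B)" using assms(1) by (simp add: algebra_simps)
qed (auto intro: span_base)

text \<open>Applying \<open>\<phi> k\<close> to a vanishing combination isolates its
  \<open>k\<close>-th coefficient. Linearity is asked only on combinations of \<open>e\<close>, as
  functionals such as \<open>g p u (v k)\<close> are controlled only on the tangent space;
  \<open>c\<close> leaves room for scaled gradients.\<close>

lemma independent_dual:
  fixes e :: "'i \<Rightarrow> 'v::real_vector" and \<phi> :: "'i \<Rightarrow> 'v \<Rightarrow> real"
  assumes "finite J" "c \<noteq> 0"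
    and lin: "\<And>a k. k \<in> J \<Longrightarrow> \<phi> k (\<Sum>j\<in>J. a j *\<^sub>R e j) = (\<Sum>j\<in>J. a j * \<phi> k (e j))"
    and dual: "\<And>j k. j \<in> J \<Longrightarrow> k \<in> J \<Longrightarrow> \<phi> k (e j) = (if j = k then c else 0)"
  shows "inj_on e J" "independent (e ` J)"
proof -
  show inj: "inj_on e J"
    by (rule inj_onI) (metis assms(2) dual)
  show "independent (e ` J)"
  proof (rule independent_if_scalars_zero)
    fix f x assume s: "(\<Sum>x\<in>e ` J. f x *\<^sub>R x) = 0" and "x \<in> e ` J"
    then obtain k where k: "k \<in> J" "x = e k" by auto
    have z: "\<phi> k 0 = 0" using lin[OF k(1), of "\<lambda>_. 0"] by simp
    have "(\<Sum>j\<in>J. f (e j) *\<^sub>R e j) = 0" using s inj by (simp add: sum.reindex)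
    then have "(\<Sum>j\<in>J. f (e j) * \<phi> k (e j)) = 0" using lin[OF k(1), of "\<lambda>j. f (e j)"] z by simp
    moreover have "(\<Sum>j\<in>J. f (e j) * \<phi> k (e j)) = (\<Sum>j\<in>J. if j = k then f (e j) * c else 0)"
      by (intro sum.cong) (auto simp: dual k)
    ultimately show "f x = 0" using k assms(1,2) by simp
  qed (use assms in auto)
qed

locale riemannian = smooth_manifold A
  for A :: "('m::{t2_space,second_countable_topology}, 'a::euclidean_space) atlas" +
  fixes g :: "'m \<Rightarrow> 'm tvec \<Rightarrow> 'm tvec \<Rightarrow> real"
  assumes metric: "riemannian_metric A g"
begin

section \<open>Bilinearity and positivity of the metric\<close>

lemma g_lincomb_left: "u \<in> T p \<Longrightarrow> v \<in> T p \<Longrightarrow> w \<in> T p \<Longrightarrow>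
    g p (a *\<^sub>R u + b *\<^sub>R v) w = a * g p u w + b * g p v w"
  using metric by (simp add: riemannian_metric_def)

lemma g_sym: "u \<in> T p \<Longrightarrow> v \<in> T p \<Longrightarrow> g p u v = g p v u"
  using metric by (simp add: riemannian_metric_def)

lemma g_pos: "u \<in> T p \<Longrightarrow> u \<noteq> 0 \<Longrightarrow> g p u u > 0"
  using metric by (simp add: riemannian_metric_def)

lemma smooth_g: "vector_field A X \<Longrightarrow> vector_field A Y \<Longrightarrow> smooth_fun A (\<lambda>p. g p (X p) (Y p))"
  using metric by (simp add: riemannian_metric_def)

lemma g_add: "u \<in> T p \<Longrightarrow> v \<in> T p \<Longrightarrow> w \<in> T p \<Longrightarrow> g p (u + v) w = g p u w + g p v w"
  "u \<in> T p \<Longrightarrow> v \<in> T p \<Longrightarrow> w \<in> T p \<Longrightarrow> g p w (u + v) = g p w u + g p w v"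
  using g_lincomb_left[of u p v w 1 1] g_sym subspace_add[OF tangent_subspace, of u p v] by auto

lemma g_scale: "u \<in> T p \<Longrightarrow> w \<in> T p \<Longrightarrow> g p (a *\<^sub>R u) w = a * g p u w"
  "u \<in> T p \<Longrightarrow> w \<in> T p \<Longrightarrow> g p w (a *\<^sub>R u) = a * g p w u"
  using g_lincomb_left[of u p u w a 0] g_sym subspace_scale[OF tangent_subspace, of u p a] by auto

lemma g_zero: "w \<in> T p \<Longrightarrow> g p 0 w = 0" "w \<in> T p \<Longrightarrow> g p w 0 = 0"
  using g_scale[of 0 p w 0] subspace_0[OF tangent_subspace] by auto

lemma g_diff: "u \<in> T p \<Longrightarrow> v \<in> T p \<Longrightarrow> w \<in> T p \<Longrightarrow> g p (u - v) w = g p u w - g p v w"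
  "u \<in> T p \<Longrightarrow> v \<in> T p \<Longrightarrow> w \<in> T p \<Longrightarrow> g p w (u - v) = g p w u - g p w v"
  using g_lincomb_left[of u p v w 1 "-1"] g_sym subspace_diff[OF tangent_subspace, of u p v] by auto

lemma g_sum:
  assumes "w \<in> T p" "\<And>i. i \<in> I \<Longrightarrow> f i \<in> T p"
  shows "g p (\<Sum>i\<in>I. f i) w = (\<Sum>i\<in>I. g p (f i) w)"
  using assms(2)
  by (induction I rule: infinite_finite_induct)
    (auto simp: g_zero assms(1) g_add subspace_sum[OF tangent_subspace])

lemma g_nonneg: "u \<in> T p \<Longrightarrow> g p u u \<ge> 0"
  using g_pos[of u p] g_zero[of u p] by (cases "u = 0") auto

lemma g_eq_0_iff: "u \<in> T p \<Longrightarrow> g p u u = 0 \<longleftrightarrow> u = 0"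
  using g_pos[of u p] g_zero[of u p] by (cases "u = 0") auto

lemma orthogonal_span:
  assumes "B \<subseteq> T p" "v \<in> T p" "\<And>b. b \<in> B \<Longrightarrow> g p b v = 0" "u \<in> span B"
  shows "g p u v = 0"
proof -
  have "subspace {u \<in> T p. g p u v = 0}"
    using tangent_subspace[of p] assms(2) by (auto simp: subspace_def g_zero g_add g_scale)
  then have "span B \<subseteq> {u \<in> T p. g p u v = 0}"
    by (intro span_minimal) (use assms in auto)
  then show ?thesis using assms(4) by auto
qed

lemma span_fields_in_tangent:
  assumes "\<And>X. X \<in> S \<Longrightarrow> vector_field A X"
  shows "span ((\<lambda>X. X p) ` S) \<subseteq> T p"
  using assms by (intro span_minimal tangent_subspace) (auto intro: vector_fieldD)

text \<open>Orthogonality holds at every point, but members may vanish somewhere;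
  \<open>norm_prod\<close> is nonzero exactly where none does. This keeps frames globally smooth
  although they are nondegenerate only locally.\<close>

definition orthogonal_fields :: "'m vfield set \<Rightarrow> bool" where
  "orthogonal_fields S \<longleftrightarrow> finite S \<and> (\<forall>X\<in>S. vector_field A X) \<and>
     (\<forall>X\<in>S. \<forall>Y\<in>S. X \<noteq> Y \<longrightarrow> (\<forall>p. g p (X p) (Y p) = 0))"

definition norm_prod :: "'m vfield set \<Rightarrow> 'm \<Rightarrow> real" where
  "norm_prod S p = (\<Prod>X\<in>S. g p (X p) (X p))"

text \<open>
  The representative \<open>\<Sum>\<^sub>X l(X) X / |X|\<^sup>2\<close> of a linear form \<open>l\<close> in an orthogonal frame, multiplied
  by \<open>norm_prod S\<close> so that it is a global smooth field even where some \<open>X\<close> vanishes.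
\<close>

definition riesz :: "'m vfield set \<Rightarrow> ('m \<Rightarrow> 'm tvec \<Rightarrow> real) \<Rightarrow> 'm vfield" where
  "riesz S l p = (\<Sum>X\<in>S. (l p (X p) * norm_prod (S - {X}) p) *\<^sub>R X p)"

lemma orthogonal_fieldsD:
  assumes "orthogonal_fields S"
  shows "finite S" "X \<in> S \<Longrightarrow> vector_field A X"
    "X \<in> S \<Longrightarrow> Y \<in> S \<Longrightarrow> X \<noteq> Y \<Longrightarrow> g p (X p) (Y p) = 0"
  using assms by (auto simp: orthogonal_fields_def)

lemma smooth_norm_prod: "(\<And>X. X \<in> S \<Longrightarrow> vector_field A X) \<Longrightarrow> smooth_fun A (norm_prod S)"
  unfolding norm_prod_def[abs_def] by (intro smooth_fun_prod smooth_g)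

lemma norm_prod_nonzero:
  assumes "orthogonal_fields S"
  shows "norm_prod S p \<noteq> 0 \<longleftrightarrow> (\<forall>X\<in>S. X p \<noteq> 0)"
  using assms by (auto simp: norm_prod_def orthogonal_fields_def g_eq_0_iff vector_fieldD)

lemma riesz_vector_field:
  assumes "orthogonal_fields S" "\<And>X. X \<in> S \<Longrightarrow> smooth_fun A (\<lambda>p. l p (X p))"
  shows "vector_field A (riesz S l)"
  unfolding riesz_def[abs_def]
  by (intro vector_field_sum vector_field_scale smooth_fun_mult smooth_norm_prod assms(2))
    (use orthogonal_fieldsD(2)[OF assms(1)] in auto)

lemma riesz_in_span: "riesz S l p \<in> span ((\<lambda>X. X p) ` S)"
  unfolding riesz_def by (intro span_sum span_scale span_base) auto

text \<open>Orthogonality leaves the summand \<open>X = Y\<close>, whose factor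
  \<open>g p (Y p) (Y p)\<close> completes the product to \<open>norm_prod S p\<close>.\<close>

lemma riesz_inner_elem:
  assumes S: "orthogonal_fields S" and Y: "Y \<in> S"
  shows "g p (riesz S l p) (Y p) = norm_prod S p * l p (Y p)"
proof -
  note D = orthogonal_fieldsD[OF S]
  have "g p (riesz S l p) (Y p) =
      (\<Sum>X\<in>S. g p ((l p (X p) * norm_prod (S - {X}) p) *\<^sub>R X p) (Y p))"
    unfolding riesz_def
    by (intro g_sum vector_fieldD D(2) Y subspace_scale[OF tangent_subspace])
  also have "\<dots> = (\<Sum>X\<in>S. if X = Y then l p (Y p) * norm_prod (S - {Y}) p * g p (Y p) (Y p) else 0)"
    by (intro sum.cong refl) (auto simp: g_scale vector_fieldD D(2) Y D(3))
  also have "\<dots> = l p (Y p) * (g p (Y p) (Y p) * norm_prod (S - {Y}) p)"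
    using D(1) Y by simp
  also have "g p (Y p) (Y p) * norm_prod (S - {Y}) p = norm_prod S p"
    using D(1) Y by (simp add: norm_prod_def prod.remove)
  finally show ?thesis by simp
qed

lemma riesz_inner:
  assumes S: "orthogonal_fields S" and v: "v \<in> span ((\<lambda>X. X p) ` S)"
    and l: "\<And>u w a b. u \<in> T p \<Longrightarrow> w \<in> T p \<Longrightarrow> l p (a *\<^sub>R u + b *\<^sub>R w) = a * l p u + b * l p w"
  shows "g p (riesz S l p) v = norm_prod S p * l p v"
proof -
  note D = orthogonal_fieldsD[OF S]
  let ?r = "riesz S l p"
  have sub: "span ((\<lambda>X. X p) ` S) \<subseteq> T p" by (rule span_fields_in_tangent) (rule D(2))
  have r: "?r \<in> T p" using riesz_in_span sub by blast
  note z = subspace_0[OF tangent_subspace]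
  have l0: "l p 0 = 0" using l[OF z z, of 0 0] by simp
  have la: "l p (u + w) = l p u + l p w" if "u \<in> T p" "w \<in> T p" for u w
    using l[OF that, of 1 1] by simp
  have ls: "l p (a *\<^sub>R u) = a * l p u" if "u \<in> T p" for u a
    using l[OF that that, of a 0] by simp
  have "subspace {u \<in> T p. g p ?r u = norm_prod S p * l p u}"
    using tangent_subspace[of p] r
    by (auto simp: subspace_def g_zero g_add g_scale l0 la ls distrib_left)
  then have "span ((\<lambda>X. X p) ` S) \<subseteq> {u \<in> T p. g p ?r u = norm_prod S p * l p u}"
    by (rule span_minimal[rotated]) (use riesz_inner_elem[OF S] D(2) vector_fieldD in auto)
  then show ?thesis using v by auto
qed

text \<open>Gram-Schmidt with denominators cleared: \<open>Y\<close> is multiplied by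
  \<open>norm_prod R\<close> before the Riesz representative of \<open>g(Y, _)\<close> is
  subtracted. The new field is smooth and orthogonal to \<open>R\<close> at every point; spans are
  compared only where no resulting field vanishes.\<close>

lemma gram_schmidt:
  assumes "finite S" "\<And>X. X \<in> S \<Longrightarrow> vector_field A X"
    "inj_on (\<lambda>X. X p) S" "independent ((\<lambda>X. X p) ` S)"
  shows "\<exists>R. orthogonal_fields R \<and> (\<forall>X\<in>R. X p \<noteq> 0) \<and>
    (\<forall>q. (\<forall>X\<in>R. X q \<noteq> 0) \<longrightarrow> span ((\<lambda>X. X q) ` R) = span ((\<lambda>X. X q) ` S))"
  using assms
proof (induction S rule: finite_induct)
  case empty
  show ?case by (intro exI[of _ "{}"]) (auto simp: orthogonal_fields_def)
next
  case (insert Y S)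
  have Yp: "Y p \<notin> (\<lambda>X. X p) ` S" using insert.prems(2) insert.hyps(2) by (auto simp: inj_on_def)
  then have ind: "independent ((\<lambda>X. X p) ` S)" "Y p \<notin> span ((\<lambda>X. X p) ` S)"
    using insert.prems(3) by (auto simp: independent_insert)
  have "inj_on (\<lambda>X. X p) S" using insert.prems(2) by (auto simp: inj_on_def)
  moreover have "\<And>X. X \<in> S \<Longrightarrow> vector_field A X" using insert.prems(1) by simp
  ultimately have "\<exists>R. orthogonal_fields R \<and> (\<forall>X\<in>R. X p \<noteq> 0) \<and>
    (\<forall>q. (\<forall>X\<in>R. X q \<noteq> 0) \<longrightarrow> span ((\<lambda>X. X q) ` R) = span ((\<lambda>X. X q) ` S))"
    using insert.IH ind(1) by blast
  then obtain R where R: "orthogonal_fields R" "\<And>X. X \<in> R \<Longrightarrow> X p \<noteq> 0"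
    "\<And>q. (\<forall>X\<in>R. X q \<noteq> 0) \<Longrightarrow> span ((\<lambda>X. X q) ` R) = span ((\<lambda>X. X q) ` S)"
    by (elim exE conjE) (rule that, assumption, blast+)
  note D = orthogonal_fieldsD[OF R(1)]
  have Y: "vector_field A Y" using insert.prems by simp
  define r where "r = riesz R (\<lambda>q v. g q (Y q) v)"
  define Z where "Z = (\<lambda>q. norm_prod R q *\<^sub>R Y q - r q)"
  have r: "vector_field A r"
    unfolding r_def by (intro riesz_vector_field R(1) smooth_g Y D(2))
  have rs: "r q \<in> span ((\<lambda>X. X q) ` R)" for q
    unfolding r_def by (rule riesz_in_span)
  have Z: "vector_field A Z"
    unfolding Z_def by (intro vector_field_diff vector_field_scale smooth_norm_prod r Y D(2))
  have orth: "g q (Z q) (X q) = 0" "g q (X q) (Z q) = 0" if "X \<in> R" for X q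
  proof -
    have X: "X q \<in> T q" using D(2)[OF that] vector_fieldD by blast
    show "g q (Z q) (X q) = 0"
      using riesz_inner_elem[OF R(1) that, of q "\<lambda>q v. g q (Y q) v"] X
      by (simp add: Z_def r_def[symmetric] g_diff g_scale subspace_scale[OF tangent_subspace]
          vector_fieldD(1)[OF Y] vector_fieldD(1)[OF r])
    then show "g q (X q) (Z q) = 0" using g_sym X vector_fieldD(1)[OF Z] by metis
  qed
  \<comment> \<open>Otherwise, dividing by \<open>norm_prod R p \<noteq> 0\<close>,
    \<open>Y p\<close> would lie in the span of the earlier vectors at \<open>p\<close>, against
    independence.\<close>
  have Zp: "Z p \<noteq> 0"
  proof
    assume "Z p = 0"
    then have "norm_prod R p *\<^sub>R Y p \<in> span ((\<lambda>X. X p) ` R)" using rs[of p] by (simp add: Z_def)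
    then have "(1 / norm_prod R p) *\<^sub>R norm_prod R p *\<^sub>R Y p \<in> span ((\<lambda>X. X p) ` R)"
      by (rule span_scale)
    then show False using ind(2) R(3)[of p] R(2) norm_prod_nonzero[OF R(1), of p] by auto
  qed
  show ?case
  proof (intro exI[of _ "insert Z R"] conjI allI impI)
    show "orthogonal_fields (insert Z R)"
      using D Z orth by (auto simp: orthogonal_fields_def)
    show "\<forall>X\<in>insert Z R. X p \<noteq> 0" using Zp R(2) by auto
    fix q assume nz: "\<forall>X\<in>insert Z R. X q \<noteq> 0"
    then have "norm_prod R q \<noteq> 0" by (simp add: norm_prod_nonzero[OF R(1)])
    then have "span (insert (Z q) ((\<lambda>X. X q) ` R)) = span (insert (Y q) ((\<lambda>X. X q) ` R))"
      unfolding Z_def by (rule span_insert_scale_diff[OF _ rs])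
    also have "\<dots> = span (insert (Y q) ((\<lambda>X. X q) ` S))"
      using R(3)[of q] nz by (simp add: span_insert)
    finally show "span ((\<lambda>X. X q) ` insert Z R) = span ((\<lambda>X. X q) ` insert Y S)" by simp
  qed
qed

lemma gram_schmidt_family:
  fixes Y :: "'i \<Rightarrow> 'm vfield"
  assumes "finite J" "\<And>j. j \<in> J \<Longrightarrow> vector_field A (Y j)"
    "inj_on (\<lambda>j. Y j p) J" "independent ((\<lambda>j. Y j p) ` J)"
  obtains S where "orthogonal_fields S" "norm_prod S p \<noteq> 0"
    "\<And>q. norm_prod S q \<noteq> 0 \<Longrightarrow> span ((\<lambda>X. X q) ` S) = span ((\<lambda>j. Y j q) ` J)"
proof -
  have inj: "inj_on (\<lambda>X. X p) (Y ` J)" using assms(3) by (auto simp: inj_on_def)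
  have "\<exists>S. orthogonal_fields S \<and> (\<forall>X\<in>S. X p \<noteq> 0) \<and>
    (\<forall>q. (\<forall>X\<in>S. X q \<noteq> 0) \<longrightarrow> span ((\<lambda>X. X q) ` S) = span ((\<lambda>j. Y j q) ` J))"
    using gram_schmidt[OF finite_imageI[OF assms(1), of Y] _ inj, unfolded image_image, OF _ assms(4)]
      assms(2) by blast
  then show ?thesis using that norm_prod_nonzero by metis
qed

text \<open>\<open>G f\<close> is the Riesz representative of the differential
  \<open>v \<mapsto> v f\<close>, so on \<open>W\<close> it is the gradient of \<open>f\<close>
  times \<open>N = norm_prod S\<close>; the factor avoids a division that may fail away from
  \<open>p\<close>.\<close>

lemma scaled_gradients:
  obtains W :: "'m set" and N G where "open W" "p \<in> W" "\<And>q. q \<in> W \<Longrightarrow> N q \<noteq> 0"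
    "\<And>f. smooth_fun A f \<Longrightarrow> vector_field A (G f)"
    "\<And>f q v. smooth_fun A f \<Longrightarrow> q \<in> W \<Longrightarrow> v \<in> T q \<Longrightarrow> g q (G f q) v = N q * v f"
proof (rule local_frame[of p])
  fix W :: "'m set" and x and E :: "'a \<Rightarrow> 'm vfield"
  assume W: "open W" "p \<in> W" and E: "\<And>i. i \<in> Basis \<Longrightarrow> vector_field A (E i)"
    and x: "\<And>q i j. q \<in> W \<Longrightarrow> i \<in> Basis \<Longrightarrow> j \<in> Basis \<Longrightarrow> E i q (x j) = (if i = j then 1 else 0)"
    and span: "\<And>q v. q \<in> W \<Longrightarrow> v \<in> T q \<Longrightarrow> v = (\<Sum>i\<in>(Basis :: 'a set). v (x i) *\<^sub>R E i q)"
  have "inj_on (\<lambda>i. E i p) Basis" "independent ((\<lambda>i. E i p) ` Basis)"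
    using independent_dual[of Basis 1 "\<lambda>k v. v (x k)" "\<lambda>i. E i p"] x[OF W(2)]
    by (auto simp: sum_fun_apply)
  from gram_schmidt_family[OF finite_Basis E this] obtain S where S: "orthogonal_fields S"
    "norm_prod S p \<noteq> 0"
    "\<And>q. norm_prod S q \<noteq> 0 \<Longrightarrow> span ((\<lambda>X. X q) ` S) = span ((\<lambda>i. E i q) ` Basis)"
    by metis
  obtain V where V: "open V" "p \<in> V" "\<And>q. q \<in> V \<Longrightarrow> norm_prod S q \<noteq> 0"
    using smooth_fun_nonzero_nbhd[OF smooth_norm_prod[OF orthogonal_fieldsD(2)[OF S(1)]] S(2)] by blast
  show thesis
  proof (rule that[of "W \<inter> V" "norm_prod S" "\<lambda>f. riesz S (\<lambda>q v. v f)"])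
    fix f q v assume q: "q \<in> W \<inter> V" and v: "v \<in> T q"
    have "v \<in> span ((\<lambda>i. E i q) ` Basis)"
    proof -
      have "v = (\<Sum>i\<in>Basis. v (x i) *\<^sub>R E i q)" by (rule span) (use q v in auto)
      also have "\<dots> \<in> span ((\<lambda>i. E i q) ` Basis)" by (intro span_sum span_scale span_base imageI)
      finally show ?thesis .
    qed
    then have "v \<in> span ((\<lambda>X. X q) ` S)" using S(3) V(3) q by auto
    then show "g q (riesz S (\<lambda>q v. v f) q) v = norm_prod S q * v f"
      by (rule riesz_inner[OF S(1)]) simp
  next
    fix f assume f: "smooth_fun A f"
    show "vector_field A (riesz S (\<lambda>q v. v f))"
      by (rule riesz_vector_field[OF S(1)]) (rule vector_fieldD(2)[OF orthogonal_fieldsD(2)[OF S(1)] f])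
  qed (use W V in auto)
qed

text \<open>A vector kills all \<open>f j\<close> exactly when it is orthogonal to their gradients.
  The \<open>v j\<close> witness that these are independent at \<open>p\<close>, and Gram-Schmidt
  makes them orthogonal with the same span near \<open>p\<close>.\<close>

lemma annihilator_orthogonal_frame:
  fixes f :: "'i \<Rightarrow> 'm \<Rightarrow> real"
  assumes J: "finite J" and f: "\<And>j. j \<in> J \<Longrightarrow> smooth_fun A (f j)"
    and v: "\<And>j. j \<in> J \<Longrightarrow> v j \<in> T p"
    and dual: "\<And>j k. j \<in> J \<Longrightarrow> k \<in> J \<Longrightarrow> v j (f k) = (if j = k then 1 else 0)"
  obtains W S where "open W" "p \<in> W" "orthogonal_fields S" "\<And>q. q \<in> W \<Longrightarrow> norm_prod S q \<noteq> 0"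
    "\<And>q u. q \<in> W \<Longrightarrow> u \<in> T q \<Longrightarrow> (\<forall>j\<in>J. u (f j) = 0) \<longleftrightarrow> (\<forall>X\<in>S. g q (X q) u = 0)"
proof (rule scaled_gradients[of p])
  fix W :: "'m set" and N G
  assume W: "open W" "p \<in> W" and N: "\<And>q. q \<in> W \<Longrightarrow> N q \<noteq> 0"
    and G: "\<And>f. smooth_fun A f \<Longrightarrow> vector_field A (G f)"
    "\<And>f q v. smooth_fun A f \<Longrightarrow> q \<in> W \<Longrightarrow> v \<in> T q \<Longrightarrow> g q (G f q) v = N q * v f"
  let ?Y = "\<lambda>j. G (f j)"
  have Y: "vector_field A (?Y j)" if "j \<in> J" for j using G(1) f that by blast
  have "g p (\<Sum>j\<in>J. a j *\<^sub>R ?Y j p) (v k) = (\<Sum>j\<in>J. a j * g p (?Y j p) (v k))" if "k \<in> J" for a k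
    by (subst g_sum[OF v[OF that]])
      (auto intro!: sum.cong subspace_scale[OF tangent_subspace] vector_fieldD(1)[OF Y] g_scale v that)
  \<comment> \<open>The constant \<open>c\<close> of \<open>independent_dual\<close> is
    \<open>N p\<close>, the factor by which the gradients are scaled.\<close>
  moreover have "g p (?Y j p) (v k) = (if j = k then N p else 0)" if "j \<in> J" "k \<in> J" for j k
    using G(2)[OF f[OF that(1)] W(2) v[OF that(2)]] dual[OF that(2,1)] by auto
  ultimately have "inj_on (\<lambda>j. ?Y j p) J" "independent ((\<lambda>j. ?Y j p) ` J)"
    using independent_dual[OF J N[OF W(2)], of "\<lambda>k u. g p u (v k)" "\<lambda>j. ?Y j p"] by blast+
  from gram_schmidt_family[of J ?Y, OF J Y this] obtain S where S: "orthogonal_fields S"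
    "norm_prod S p \<noteq> 0"
    "\<And>q. norm_prod S q \<noteq> 0 \<Longrightarrow> span ((\<lambda>X. X q) ` S) = span ((\<lambda>j. ?Y j q) ` J)"
    by metis
  note D = orthogonal_fieldsD[OF S(1)]
  obtain V where V: "open V" "p \<in> V" "\<And>q. q \<in> V \<Longrightarrow> norm_prod S q \<noteq> 0"
    using smooth_fun_nonzero_nbhd[OF smooth_norm_prod[OF D(2)] S(2)] by blast
  show thesis
  proof (rule that[of "W \<inter> V" S])
    fix q u assume q: "q \<in> W \<inter> V" and u: "u \<in> T q"
    have S': "(\<lambda>X. X q) ` S \<subseteq> T q" "(\<lambda>j. ?Y j q) ` J \<subseteq> T q"
      using D(2) Y vector_fieldD by auto
    have sp: "span ((\<lambda>X. X q) ` S) = span ((\<lambda>j. ?Y j q) ` J)" using S(3) V(3) q by auto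
    have "(\<forall>j\<in>J. u (f j) = 0) \<longleftrightarrow> (\<forall>j\<in>J. g q (?Y j q) u = 0)"
      using G(2)[OF f _ u] N q by simp
    also have "\<dots> \<longleftrightarrow> (\<forall>w\<in>span ((\<lambda>j. ?Y j q) ` J). g q w u = 0)"
      using orthogonal_span[OF S'(2) u] by (auto intro: span_base)
    also have "\<dots> \<longleftrightarrow> (\<forall>X\<in>S. g q (X q) u = 0)"
      unfolding sp[symmetric] using orthogonal_span[OF S'(1) u] by (auto intro: span_base)
    finally show "(\<forall>j\<in>J. u (f j) = 0) \<longleftrightarrow> (\<forall>X\<in>S. g q (X q) u = 0)" .
  qed (use W V S(1) in auto)
qed

end

section \<open>The vertical projection of a submersion\<close>

lemma smooth_fun_compose_map:
  assumes A: "smooth_manifold A" and B: "smooth_manifold B"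
    and F: "smooth_map A B F" and h: "smooth_fun B h"
  shows "smooth_fun A (\<lambda>q. h (F q))"
proof (rule smooth_manifold.smooth_funI_local[OF A])
  fix U c q assume Uc: "(U, c) \<in> A" and "q \<in> U"
  obtain V d where Vd: "(V, d) \<in> B" "F q \<in> V" by (rule smooth_manifold.chart_ex[OF B])
  have o: "open (F -` V)"
    using F smooth_manifold.chartD(1)[OF B Vd(1)] by (auto simp: smooth_map_def intro: open_vimage)
  have o': "open (c ` (U \<inter> F -` V))" by (rule smooth_manifold.chart_open_image[OF A Uc o])
  have s: "smooth_on (c ` (U \<inter> F -` V)) (d \<circ> F \<circ> inv_into U c)"
    using F Uc Vd(1) unfolding smooth_map_def by fastforce
  have "smooth_on (c ` (U \<inter> F -` V)) (\<lambda>y. h (inv_into V d ((d \<circ> F \<circ> inv_into U c) y)))"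
    by (rule smooth_on_compose[OF o' smooth_manifold.chartD(2)[OF B Vd(1)] _ s
          smooth_manifold.smooth_funD[OF B h Vd(1)]])
      (auto simp: smooth_manifold.chart_inv[OF A Uc])
  then have "smooth_on (c ` (U \<inter> F -` V)) (\<lambda>y. h (F (inv_into U c y)))"
    by (rule smooth_on_cong[OF o', rotated])
      (auto simp: smooth_manifold.chart_inv[OF A Uc] smooth_manifold.chart_inv[OF B Vd(1)])
  then show "\<exists>W. open W \<and> q \<in> W \<and> smooth_on (c ` (U \<inter> W)) (\<lambda>y. h (F (inv_into U c y)))"
    using o Vd(2) by auto
qed

locale submersion = riemannian A g
  for A :: "('m::{t2_space,second_countable_topology}, 'a::euclidean_space) atlas" and g +
  fixes B :: "('n::{t2_space,second_countable_topology}, 'b::euclidean_space) atlas"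
    and F :: "'m \<Rightarrow> 'n"
  assumes target: "smooth_manifold B"
    and smooth: "smooth_map A B F"
    and rank: "\<And>p. pushforward B F ` tangent_space A p = tangent_space B (F p)"
begin

abbreviation "\<V> p \<equiv> vertical_space A B F p"
abbreviation "\<H> p \<equiv> horizontal_space A B F g p"
abbreviation "vp p \<equiv> vproj A B F g p"

section \<open>Vertical vectors and a local frame of their orthogonal complement\<close>

lemma vertical_subspace: "subspace (\<V> p)"
  using tangent_subspace[of p]
  by (auto simp: subspace_def vertical_space_def pushforward_def fun_eq_iff split: if_splits)

lemma vertical_tangent: "v \<in> \<V> p \<Longrightarrow> v \<in> T p"
  by (simp add: vertical_space_def)

text \<open>Vertical vectors are those killed by the pulled-back coordinates
  \<open>x i \<circ> F\<close>. The frame \<open>S\<close> itself consists of horizontal vectors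
  near \<open>p\<close>.\<close>

lemma vertical_local_frame:
  obtains W S where "open W" "p \<in> W" "orthogonal_fields S" "\<And>q. q \<in> W \<Longrightarrow> norm_prod S q \<noteq> 0"
    "\<And>q u. q \<in> W \<Longrightarrow> u \<in> T q \<Longrightarrow> u \<in> \<V> q \<longleftrightarrow> (\<forall>X\<in>S. g q (X q) u = 0)"
proof (rule smooth_manifold.local_frame[OF target, of "F p"])
  fix W :: "'n set" and x and E :: "'b \<Rightarrow> 'n vfield"
  assume W: "open W" "F p \<in> W" and x: "\<And>i. i \<in> Basis \<Longrightarrow> smooth_fun B (x i)"
    and E: "\<And>i. i \<in> Basis \<Longrightarrow> vector_field B (E i)"
    and Ex: "\<And>q i j. q \<in> W \<Longrightarrow> i \<in> Basis \<Longrightarrow> j \<in> Basis \<Longrightarrow> E i q (x j) = (if i = j then 1 else 0)"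
    and span: "\<And>q v. q \<in> W \<Longrightarrow> v \<in> tangent_space B q \<Longrightarrow> v = (\<Sum>i\<in>Basis. v (x i) *\<^sub>R E i q)"
  have f: "smooth_fun A (\<lambda>q. x i (F q))" if "i \<in> Basis" for i
    by (rule smooth_fun_compose_map[OF smooth_manifold_axioms target smooth x[OF that]])
  \<comment> \<open>Surjectivity of the differential lifts the coordinate vectors at
    \<open>F p\<close> to tangent vectors dual to the functions
    \<open>x i \<circ> F\<close>.\<close>
  have "\<exists>v\<in>T p. pushforward B F v = E i (F p)" if "i \<in> Basis" for i
  proof -
    have "E i (F p) \<in> tangent_space B (F p)"
      using E[OF that] by (simp add: vector_field_def)
    then show ?thesis using rank[of p] by (metis imageE)
  qed
  then obtain v where v: "\<And>i. i \<in> Basis \<Longrightarrow> v i \<in> T p" "\<And>i. i \<in> Basis \<Longrightarrow> pushforward B F (v i) = E i (F p)"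
    by metis
  have push: "pushforward B F u (x i) = u (\<lambda>q. x i (F q))" if "i \<in> Basis" for u i
    using x[OF that] by (simp add: pushforward_def o_def)
  have dual: "v i (\<lambda>q. x j (F q)) = (if i = j then 1 else 0)" if "i \<in> Basis" "j \<in> Basis" for i j
    using push[OF that(2), of "v i"] v(2)[OF that(1)] Ex[OF W(2) that] by simp
  show thesis
  proof (rule annihilator_orthogonal_frame[of Basis "\<lambda>i q. x i (F q)" v p, OF finite_Basis f v(1) dual])
    fix V S
    assume V: "open V" "p \<in> V" and S: "orthogonal_fields S" "\<And>q. q \<in> V \<Longrightarrow> norm_prod S q \<noteq> 0"
      and ann: "\<And>q u. q \<in> V \<Longrightarrow> u \<in> T q \<Longrightarrow> (\<forall>j\<in>Basis. u (\<lambda>q. x j (F q)) = 0) \<longleftrightarrow> (\<forall>X\<in>S. g q (X q) u = 0)"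
    have o: "open (F -` W)" using smooth W(1) by (auto simp: smooth_map_def intro: open_vimage)
    show thesis
    proof (rule that[of "F -` W \<inter> V" S])
      fix q u assume q: "q \<in> F -` W \<inter> V" and u: "u \<in> T q"
      have "pushforward B F u \<in> tangent_space B (F q)" using rank[of q] u by blast
      then have rep: "pushforward B F u = (\<Sum>i\<in>Basis. pushforward B F u (x i) *\<^sub>R E i (F q))"
        using span q by blast
      \<comment> \<open>The \<open>E i\<close> span over \<open>W\<close>, so a pushforward is
        determined by its values on the coordinates.\<close>
      have "pushforward B F u = 0 \<longleftrightarrow> (\<forall>j\<in>Basis. pushforward B F u (x j) = 0)"
      proof
        assume "\<forall>j\<in>Basis. pushforward B F u (x j) = 0"
        then have "(\<Sum>i\<in>Basis. pushforward B F u (x i) *\<^sub>R E i (F q)) = 0" by simp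
        with rep show "pushforward B F u = 0" by (rule trans)
      qed simp
      also have "\<dots> \<longleftrightarrow> (\<forall>X\<in>S. g q (X q) u = 0)"
        using ann[OF _ u] q push by simp
      finally show "u \<in> \<V> q \<longleftrightarrow> (\<forall>X\<in>S. g q (X q) u = 0)"
        using u by (simp add: vertical_space_def)
    qed (use o V W S in auto)
  qed
qed

text \<open>Two candidates differ by a vector both vertical and horizontal, hence orthogonal to
  itself and zero; so the \<open>THE\<close> in \<open>vproj\<close> is unique.\<close>

lemma vproj_eqI:
  assumes "u \<in> \<V> p" "v - u \<in> \<H> p"
  shows "vp p v = u"
  unfolding vproj_def
proof (rule the_equality)
  fix w assume w: "w \<in> \<V> p \<and> v - w \<in> \<H> p"
  have "w - u \<in> \<V> p" using w assms subspace_diff[OF vertical_subspace] by blast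
  moreover have h: "v - u \<in> T p" "v - w \<in> T p" "g p (v - u) (w - u) = 0" "g p (v - w) (w - u) = 0"
    using w assms calculation by (simp_all add: horizontal_space_def)
  ultimately have "g p ((v - u) - (v - w)) (w - u) = 0"
    using g_diff(1)[OF h(1,2), of "w - u"] vertical_tangent by simp
  then have "g p (w - u) (w - u) = 0" by simp
  then have "w - u = 0" using g_eq_0_iff \<open>w - u \<in> \<V> p\<close> vertical_tangent by blast
  then show "w = u" by simp
qed (use assms in auto)

text \<open>The Riesz representative of \<open>g(X, _)\<close> divided by \<open>norm_prod S\<close>
  is the orthogonal projection onto the span of \<open>S\<close>; subtracting it leaves the vertical
  part.\<close>

lemma vproj_frame:
  assumes S: "orthogonal_fields S" "norm_prod S p \<noteq> 0"
    and vert: "\<And>u. u \<in> T p \<Longrightarrow> u \<in> \<V> p \<longleftrightarrow> (\<forall>X\<in>S. g p (X p) u = 0)"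
    and X: "X p \<in> T p"
  shows "vp p (X p) = X p - (1 / norm_prod S p) *\<^sub>R riesz S (\<lambda>q. g q (X q)) p"
    and "vp p (X p) \<in> \<V> p" "X p - vp p (X p) \<in> \<H> p"
proof -
  note D = orthogonal_fieldsD[OF S(1)]
  let ?r = "riesz S (\<lambda>q. g q (X q)) p"
  let ?w = "(1 / norm_prod S p) *\<^sub>R ?r"
  have S': "(\<lambda>X. X p) ` S \<subseteq> T p" using D(2) vector_fieldD by auto
  have rs: "?w \<in> span ((\<lambda>X. X p) ` S)" by (intro span_scale riesz_in_span)
  have "span ((\<lambda>X. X p) ` S) \<subseteq> T p" by (rule span_minimal[OF S' tangent_subspace])
  then have r: "?r \<in> T p" "?w \<in> T p" using riesz_in_span rs by auto
  have u: "X p - ?w \<in> T p" by (rule subspace_diff[OF tangent_subspace X r(2)])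
  have "X p - ?w \<in> \<V> p"
    unfolding vert[OF u]
  proof
    fix Y assume Y: "Y \<in> S"
    have Yp: "Y p \<in> T p" using D(2)[OF Y] vector_fieldD by blast
    have "g p ?r (Y p) = norm_prod S p * g p (X p) (Y p)" by (rule riesz_inner_elem[OF S(1) Y])
    then have "g p (X p - ?w) (Y p) = 0"
      using S(2) by (simp add: g_diff(1)[OF X r(2) Yp] g_scale(1)[OF r(1) Yp])
    then show "g p (Y p) (X p - ?w) = 0" using g_sym[OF Yp u] by simp
  qed
  moreover have "g p ?w u = 0" if "u \<in> \<V> p" for u
    using orthogonal_span[OF S' vertical_tangent[OF that] _ rs] vert[OF vertical_tangent[OF that]] that
    by auto
  then have "X p - (X p - ?w) \<in> \<H> p"
    using r(2) by (simp add: horizontal_space_def)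
  moreover note vproj_eqI[OF calculation]
  ultimately show "vp p (X p) = X p - ?w" "vp p (X p) \<in> \<V> p" "X p - vp p (X p) \<in> \<H> p" by auto
qed

lemma
  assumes v: "v \<in> T p"
  shows vproj_vertical: "vp p v \<in> \<V> p" and vproj_horizontal: "v - vp p v \<in> \<H> p"
proof -
  have "vp p v \<in> \<V> p \<and> v - vp p v \<in> \<H> p"
  proof (rule vertical_local_frame[of p])
    fix W S assume p: "p \<in> W" and S: "orthogonal_fields S" "\<And>q. q \<in> W \<Longrightarrow> norm_prod S q \<noteq> 0"
      and vert: "\<And>q u. q \<in> W \<Longrightarrow> u \<in> T q \<Longrightarrow> u \<in> \<V> q \<longleftrightarrow> (\<forall>X\<in>S. g q (X q) u = 0)"
    show ?thesis
      \<comment> \<open>Only the value at \<open>p\<close> enters, so a constant family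
        serves.\<close>
      using vproj_frame(2,3)[OF S(1) S(2)[OF p] vert[OF p], of "\<lambda>_. v"] v by blast
  qed
  then show "vp p v \<in> \<V> p" "v - vp p v \<in> \<H> p" by auto
qed

text \<open>Near each point \<open>vproj_frame\<close> writes the projection as globally smooth data
  divided by the nonvanishing \<open>norm_prod S\<close>.\<close>

lemma vproj_vector_field:
  assumes X: "vector_field A X"
  shows "vector_field A (\<lambda>p. vp p (X p))"
  unfolding vector_field_def
proof (intro conjI allI impI)
  show "vp p (X p) \<in> T p" for p using vproj_vertical vertical_tangent vector_fieldD(1)[OF X] by blast
  fix f assume f: "smooth_fun A f"
  show "smooth_fun A (\<lambda>p. vp p (X p) f)"
  proof (rule smooth_fun_local_quotient, rule vertical_local_frame)
    fix p W S assume W: "open W" "p \<in> W" and S: "orthogonal_fields S" "\<And>q. q \<in> W \<Longrightarrow> norm_prod S q \<noteq> 0"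
      and vert: "\<And>q u. q \<in> W \<Longrightarrow> u \<in> T q \<Longrightarrow> u \<in> \<V> q \<longleftrightarrow> (\<forall>X\<in>S. g q (X q) u = 0)"
    note D = orthogonal_fieldsD[OF S(1)]
    let ?r = "riesz S (\<lambda>q. g q (X q))"
    have r: "vector_field A ?r" by (intro riesz_vector_field S(1) smooth_g X D(2))
    have N: "smooth_fun A (norm_prod S)" by (intro smooth_norm_prod D(2))
    have "smooth_fun A (\<lambda>q. norm_prod S q * X q f - ?r q f)"
      by (intro smooth_fun_diff smooth_fun_mult N vector_fieldD(2)[OF X f] vector_fieldD(2)[OF r f])
    moreover have "vp q (X q) f = (norm_prod S q * X q f - ?r q f) / norm_prod S q" if "q \<in> W" for q
      by (subst vproj_frame(1)[where X = X and p = q, OF S(1) S(2)[OF that] vert[OF that] vector_fieldD(1)[OF X]])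
        (simp_all add: S(2)[OF that] diff_divide_distrib)
    ultimately show "\<exists>W n d. open W \<and> p \<in> W \<and> smooth_fun A n \<and> smooth_fun A d \<and>
        (\<forall>q\<in>W. d q \<noteq> 0 \<and> vp q (X q) f = n q / d q)"
      by (intro exI[of _ W] exI[of _ "\<lambda>q. norm_prod S q * X q f - ?r q f"] exI[of _ "norm_prod S"]
          conjI ballI W N S(2))
  qed
qed

lemma g_vproj:
  assumes "v \<in> T p" "u \<in> \<V> p"
  shows "g p (vp p v) u = g p v u" "g p u (vp p v) = g p u v"
proof -
  have "g p (v - vp p v) u = 0" using vproj_horizontal[OF assms(1)] assms(2) by (auto simp: horizontal_space_def)
  moreover have t: "vp p v \<in> T p" "u \<in> T p" using vproj_vertical assms vertical_tangent by blast+
  ultimately show "g p (vp p v) u = g p v u" using assms by (simp add: g_diff)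
  then show "g p u (vp p v) = g p u v" using t assms(1) g_sym by metis
qed

lemma vertical_ext:
  assumes "u \<in> \<V> p" "v \<in> \<V> p" "\<And>w. w \<in> \<V> p \<Longrightarrow> g p u w = g p v w"
  shows "u = v"
proof -
  have "u - v \<in> \<V> p" by (rule subspace_diff[OF vertical_subspace assms(1,2)])
  then have "g p (u - v) (u - v) = 0" using assms vertical_tangent by (simp add: g_diff)
  then have "u - v = 0" using g_eq_0_iff \<open>u - v \<in> \<V> p\<close> vertical_tangent by blast
  then show ?thesis by simp
qed

lemma vproj_ident: "v \<in> \<V> p \<Longrightarrow> vp p v = v"
  by (rule vproj_eqI)
    (auto simp: horizontal_space_def subspace_0[OF tangent_subspace] g_zero vertical_tangent)

lemma vproj_zero: "vp p 0 = 0"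
  by (rule vproj_ident) (rule subspace_0[OF vertical_subspace])

text \<open>Extend to any field, then project; the projection fixes \<open>v\<close>.\<close>

lemma vertical_field_extension:
  assumes "v \<in> \<V> p"
  obtains X where "vertical_field A B F X" "X p = v"
proof -
  obtain X where X: "vector_field A X" "X p = v"
    using vector_field_extension[OF vertical_tangent[OF assms]] .
  have "vertical_field A B F (\<lambda>p. vp p (X p))"
    unfolding vertical_field_def
    using vproj_vector_field[OF X(1)] vproj_vertical vector_fieldD(1)[OF X(1)] by blast
  then show ?thesis using that X(2) vproj_ident[OF assms] by simp
qed

text \<open>\<open>X\<close> and \<open>Y\<close> kill every \<open>h \<circ> F\<close>, so each
  iterated derivative differentiates the constant 0. That the bracket is a tangent vector is later
  supplied by torsion-freeness.\<close>

lemma lie_bracket_vertical: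
  assumes "vertical_field A B F X" "vertical_field A B F Y" "lie_bracket X Y p \<in> T p"
  shows "lie_bracket X Y p \<in> \<V> p"
proof -
  have z: "Z q (h \<circ> F) = 0" if "vertical_field A B F Z" "smooth_fun B h" for Z q h
    using that by (auto simp: vertical_field_def vertical_space_def pushforward_def fun_eq_iff split: if_splits)
  have XY: "X p \<in> T p" "Y p \<in> T p" using assms by (auto simp: vertical_field_def vertical_tangent)
  have "lie_bracket X Y p (h \<circ> F) = 0" if "smooth_fun B h" for h
    using z[OF assms(1) that] z[OF assms(2) that] tangent_const[OF XY(1)] tangent_const[OF XY(2)]
    by (simp add: lie_bracket_def)
  then have "pushforward B F (lie_bracket X Y p) = 0"
    by (auto simp: pushforward_def)
  then show ?thesis using assms(3) by (simp add: vertical_space_def)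
qed

end

section \<open>Slant submersions from contact metric manifolds\<close>

locale contact_submersion = submersion A g B F
  for A :: "('m::{t2_space,second_countable_topology}, 'a::euclidean_space) atlas" and g
    and B :: "('n::{t2_space,second_countable_topology}, 'b::euclidean_space) atlas" and F +
  fixes \<phi> :: "'m \<Rightarrow> 'm tvec \<Rightarrow> 'm tvec" and \<xi> :: "'m vfield" and \<eta> :: "'m \<Rightarrow> 'm tvec \<Rightarrow> real"
  assumes contact: "contact_metric A \<phi> \<xi> \<eta> g"
begin

section \<open>Almost contact identities at a point\<close>

lemma acm: "almost_contact_metric A \<phi> \<xi> \<eta> g"
  using contact by (simp add: contact_metric_def)

lemma xi_field: "vector_field A \<xi>"
  using acm by (simp add: almost_contact_metric_def)

lemmas xi_tangent = vector_fieldD(1)[OF xi_field]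

lemma phi_field: "vector_field A X \<Longrightarrow> vector_field A (\<lambda>p. \<phi> p (X p))"
  using acm by (simp add: almost_contact_metric_def tensor_field_11_def)

lemma phi_tangent: "u \<in> T p \<Longrightarrow> \<phi> p u \<in> T p"
  using acm by (simp add: almost_contact_metric_def tensor_field_11_def)

lemma phi_lincomb: "u \<in> T p \<Longrightarrow> v \<in> T p \<Longrightarrow> \<phi> p (a *\<^sub>R u + b *\<^sub>R v) = a *\<^sub>R \<phi> p u + b *\<^sub>R \<phi> p v"
  using acm by (simp add: almost_contact_metric_def tensor_field_11_def)

lemma phi_zero: "\<phi> p 0 = 0"
  using phi_lincomb[of 0 p 0 0 0] subspace_0[OF tangent_subspace] by simp

lemma phi_add: "u \<in> T p \<Longrightarrow> v \<in> T p \<Longrightarrow> \<phi> p (u + v) = \<phi> p u + \<phi> p v"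
  using phi_lincomb[of u p v 1 1] by simp

lemma phi_phi: "u \<in> T p \<Longrightarrow> \<phi> p (\<phi> p u) = - u + \<eta> p u *\<^sub>R \<xi> p"
  using acm by (simp add: almost_contact_metric_def)

lemma phi_xi: "\<phi> p (\<xi> p) = 0"
  using acm by (simp add: almost_contact_metric_def)

lemma eta_phi: "u \<in> T p \<Longrightarrow> \<eta> p (\<phi> p u) = 0"
  using acm by (simp add: almost_contact_metric_def)

lemma g_phi_phi: "u \<in> T p \<Longrightarrow> v \<in> T p \<Longrightarrow> g p (\<phi> p u) (\<phi> p v) = g p u v - \<eta> p u * \<eta> p v"
  using acm by (simp add: almost_contact_metric_def)

lemma eta_eq: "u \<in> T p \<Longrightarrow> \<eta> p u = g p u (\<xi> p)"
  using acm by (simp add: almost_contact_metric_def)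

lemma smooth_eta: "vector_field A X \<Longrightarrow> smooth_fun A (\<lambda>p. \<eta> p (X p))"
  using acm by (simp add: almost_contact_metric_def one_form_def)

lemma ext_deriv_eta: "vector_field A X \<Longrightarrow> vector_field A Y \<Longrightarrow> ext_deriv \<eta> X Y p = g p (X p) (\<phi> p (Y p))"
  using contact by (simp add: contact_metric_def)

lemma eta_add: "u \<in> T p \<Longrightarrow> v \<in> T p \<Longrightarrow> \<eta> p (u + v) = \<eta> p u + \<eta> p v"
  using subspace_add[OF tangent_subspace, of u p v] by (simp add: eta_eq g_add xi_tangent)

lemma eta_diff: "u \<in> T p \<Longrightarrow> v \<in> T p \<Longrightarrow> \<eta> p (u - v) = \<eta> p u - \<eta> p v"
  using subspace_diff[OF tangent_subspace, of u p v] by (simp add: eta_eq g_diff xi_tangent)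

text \<open>Apply compatibility of \<open>g\<close> with \<open>\<phi>\<close> to \<open>u\<close>
  and \<open>\<phi> p v\<close>; the \<open>\<eta>\<close> terms drop out because
  \<open>\<eta>\<close> vanishes on the image of \<open>\<phi>\<close>.\<close>

lemma phi_skew:
  assumes "u \<in> T p" "v \<in> T p"
  shows "g p (\<phi> p u) v = - g p u (\<phi> p v)"
proof -
  note t = phi_tangent[OF assms(1)] phi_tangent[OF assms(2)] xi_tangent[of p]
  have "g p u (\<phi> p v) = g p (\<phi> p u) (\<phi> p (\<phi> p v))"
    using g_phi_phi[OF assms(1) t(2)] eta_phi[OF assms(2)] by simp
  also have "\<dots> = g p (\<phi> p u) (\<eta> p v *\<^sub>R \<xi> p - v)" using phi_phi[OF assms(2)] by simp
  also have "\<dots> = \<eta> p v * \<eta> p (\<phi> p u) - g p (\<phi> p u) v"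
    using g_diff(2)[OF subspace_scale[OF tangent_subspace t(3), of "\<eta> p v"] assms(2) t(1)]
      g_scale(2)[OF t(3) t(1)] eta_eq[OF t(1)] by simp
  finally show ?thesis using eta_phi[OF assms(1)] by simp
qed

text \<open>As \<open>vproj\<close> is a definite description, additivity is tested by inner
  products with vertical vectors.\<close>

lemma vproj_add:
  assumes "u \<in> T p" "v \<in> T p"
  shows "vp p (u + v) = vp p u + vp p v"
  using assms subspace_add[OF tangent_subspace assms] subspace_add[OF vertical_subspace]
  by (intro vertical_ext[of _ p])
    (simp_all add: vproj_vertical g_vproj g_add vertical_tangent)

lemma vproj_diff:
  assumes "u \<in> T p" "v \<in> T p"
  shows "vp p (u - v) = vp p u - vp p v"
  using assms subspace_diff[OF tangent_subspace assms] subspace_diff[OF vertical_subspace]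
  by (intro vertical_ext[of _ p])
    (simp_all add: vproj_vertical g_vproj g_diff vertical_tangent)

section \<open>The operator \<open>\<psi>\<close> and the slant condition\<close>

abbreviation "\<psi> p \<equiv> psi A B F g \<phi> p"

lemma psi_vertical: "u \<in> \<V> p \<Longrightarrow> \<psi> p u \<in> \<V> p"
  unfolding psi_def by (intro vproj_vertical phi_tangent vertical_tangent)

lemma psi_zero: "\<psi> p 0 = 0"
  by (simp add: psi_def phi_zero vproj_zero)

lemma psi_add: "u \<in> \<V> p \<Longrightarrow> v \<in> \<V> p \<Longrightarrow> \<psi> p (u + v) = \<psi> p u + \<psi> p v"
  unfolding psi_def by (simp add: phi_add vproj_add vertical_tangent phi_tangent)

lemma g_psi: "u \<in> \<V> p \<Longrightarrow> v \<in> \<V> p \<Longrightarrow> g p (\<psi> p u) v = g p (\<phi> p u) v"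
  unfolding psi_def by (intro g_vproj phi_tangent vertical_tangent)

lemma psi_skew:
  assumes "u \<in> \<V> p" "v \<in> \<V> p"
  shows "g p (\<psi> p u) v = - g p u (\<psi> p v)"
proof -
  note t = vertical_tangent[OF assms(1)] vertical_tangent[OF assms(2)]
  have "g p u (\<psi> p v) = g p u (\<phi> p v)"
    unfolding psi_def by (rule g_vproj(2)[OF phi_tangent[OF t(2)] assms(1)])
  then show ?thesis using g_psi[OF assms] phi_skew[OF t] by simp
qed

lemma psi_field: "vertical_field A B F V \<Longrightarrow> vertical_field A B F (\<lambda>p. \<psi> p (V p))"
  using vproj_vector_field[OF phi_field, of V] psi_vertical unfolding vertical_field_def psi_def by auto

text \<open>If \<open>\<phi> p u = 0\<close>, the formula for \<open>\<phi>\<^sup>2\<close> gives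
  \<open>u = \<eta>(u) \<xi>\<close>. This keeps the denominator in the slant angle
  positive.\<close>

lemma phi_nonzero:
  assumes "u \<in> T p" "\<And>c. u \<noteq> c *\<^sub>R \<xi> p"
  shows "\<phi> p u \<noteq> 0"
proof
  assume "\<phi> p u = 0"
  then have "u = \<eta> p u *\<^sub>R \<xi> p" using phi_phi[OF assms(1)] phi_zero by (simp add: eq_neg_iff_add_eq_0)
  then show False using assms(2) by blast
qed

text \<open>Expand \<open>0 \<le> |\<phi> u - \<psi> u|\<^sup>2\<close> using
  \<open>g(\<phi> u, \<psi> u) = |\<psi> u|\<^sup>2\<close>. The bound puts the quotient in the
  angle into [0, 1], where \<open>cos\<close> undoes \<open>arccos\<close>.\<close>

lemma psi_le_phi:
  assumes u: "u \<in> \<V> p"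
  shows "g p (\<psi> p u) (\<psi> p u) \<le> g p (\<phi> p u) (\<phi> p u)"
proof -
  let ?a = "\<phi> p u" and ?b = "\<psi> p u"
  have t: "?a \<in> T p" "?b \<in> T p" using u psi_vertical vertical_tangent phi_tangent by blast+
  have "0 \<le> g p (?a - ?b) (?a - ?b)" by (rule g_nonneg[OF subspace_diff[OF tangent_subspace t]])
  also have "\<dots> = g p ?a ?a - g p ?a ?b - (g p ?b ?a - g p ?b ?b)"
    using t subspace_diff[OF tangent_subspace t] by (simp add: g_diff)
  also have "g p ?b ?a = g p ?a ?b" by (rule g_sym[OF t(2,1)])
  also have "g p ?a ?b = g p ?b ?b" using g_psi[OF u psi_vertical[OF u]] by simp
  finally show ?thesis by simp
qed

text \<open>Off the line of \<open>\<xi>\<close> the slant condition reads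
  \<open>cos \<theta> = |\<psi> u| / |\<phi> u|\<close>, and
  \<open>|\<phi> u|\<^sup>2 = |u|\<^sup>2 - \<eta>(u)\<^sup>2\<close>. For vertical multiples of
  \<open>\<xi>\<close>, exempt from the condition, both sides are 0, so the formula holds on the
  whole vertical space and can be polarised.\<close>

lemma slant_psi_norm:
  assumes slant: "slant_submersion_with_angle A B F \<phi> \<xi> g gN \<theta>" and u: "u \<in> \<V> p"
  shows "g p (\<psi> p u) (\<psi> p u) = (cos \<theta>)\<^sup>2 * (g p u u - \<eta> p u * \<eta> p u)"
proof (cases "\<exists>c. u = c *\<^sub>R \<xi> p")
  case True
  then obtain c where c: "u = c *\<^sub>R \<xi> p" by blast
  have x: "\<xi> p \<in> T p" by (rule xi_tangent)
  have "\<phi> p u = 0" using phi_lincomb[OF x x, of c 0] c phi_xi by simp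
  moreover have "g p u u - \<eta> p u * \<eta> p u = g p (\<phi> p u) (\<phi> p u)"
    by (rule g_phi_phi[symmetric]) (rule vertical_tangent[OF u])+
  moreover have "g p 0 0 = 0" using g_zero[OF x] subspace_0[OF tangent_subspace] g_zero(1) by blast
  ultimately show ?thesis by (simp add: psi_def vproj_zero)
next
  case False
  let ?P = "g p (\<psi> p u) (\<psi> p u)" and ?N = "g p (\<phi> p u) (\<phi> p u)"
  have t: "u \<in> T p" "\<phi> p u \<in> T p" "\<psi> p u \<in> T p"
    using u psi_vertical vertical_tangent phi_tangent by blast+
  have nz: "u \<noteq> 0" using False scaleR_zero_left[of "\<xi> p"] by metis
  have N: "?N > 0" using phi_nonzero[OF t(1)] False g_pos[OF t(2)] by blast
  have P: "0 \<le> ?P" "?P \<le> ?N" using g_nonneg[OF t(3)] psi_le_phi[OF u] by auto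
  have "\<theta> = arccos (sqrt ?P / sqrt ?N)"
    using slant u nz False
    by (auto simp: slant_submersion_with_angle_def angle_vertical_def tnorm_def psi_def)
  moreover have "sqrt ?P / sqrt ?N \<le> 1" "0 \<le> sqrt ?P / sqrt ?N" using P N by (auto simp: divide_le_eq)
  ultimately have "cos \<theta> = sqrt ?P / sqrt ?N" by (simp add: cos_arccos)
  then have "(cos \<theta>)\<^sup>2 = ?P / ?N" using P N by (simp add: power_divide)
  then have "?P = (cos \<theta>)\<^sup>2 * ?N" using N by simp
  then show ?thesis using g_phi_phi[OF t(1) t(1)] by simp
qed

text \<open>Polarisation: compare the norm formula for \<open>u + v\<close>, \<open>u\<close> and
  \<open>v\<close>.\<close>

lemma slant_psi_inner:
  assumes slant: "slant_submersion_with_angle A B F \<phi> \<xi> g gN \<theta>" and u: "u \<in> \<V> p" and v: "v \<in> \<V> p"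
  shows "g p (\<psi> p u) (\<psi> p v) = (cos \<theta>)\<^sup>2 * (g p u v - \<eta> p u * \<eta> p v)"
proof -
  have uv: "u + v \<in> \<V> p" by (rule subspace_add[OF vertical_subspace u v])
  note t = vertical_tangent[OF u] vertical_tangent[OF v]
  note tp = vertical_tangent[OF psi_vertical[OF u]] vertical_tangent[OF psi_vertical[OF v]]
  have add2: "g p (a + b) (a + b) = g p a a + 2 * g p a b + g p b b" if "a \<in> T p" "b \<in> T p" for a b
    using that subspace_add[OF tangent_subspace that] g_sym[OF that] by (simp add: g_add)
  show ?thesis
    using slant_psi_norm[OF slant uv] slant_psi_norm[OF slant u] slant_psi_norm[OF slant v]
    unfolding psi_add[OF u v] add2[OF t] add2[OF tp] eta_add[OF t]
    by (simp add: algebra_simps)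
qed

text \<open>Skewness moves one \<open>\<psi>\<close> across. This is the formula for
  \<open>Q\<close> in the slant case, tested against vertical vectors.\<close>

lemma slant_psi_psi_inner:
  assumes "slant_submersion_with_angle A B F \<phi> \<xi> g gN \<theta>" "u \<in> \<V> p" "v \<in> \<V> p"
  shows "g p (\<psi> p (\<psi> p u)) v = - (cos \<theta>)\<^sup>2 * (g p u v - \<eta> p u * \<eta> p v)"
  using psi_skew[OF psi_vertical[OF assms(2)] assms(3)] slant_psi_inner[OF assms] by simp

text \<open>Forwards, \<open>cos (pi / 2) = 0\<close> in the norm formula; backwards, a zero
  projection gives the angle \<open>arccos 0\<close>.\<close>

lemma anti_invariant_iff_psi:
  assumes slant: "slant_submersion_with_angle A B F \<phi> \<xi> g gN \<theta>"
  shows "slant_submersion_with_angle A B F \<phi> \<xi> g gN (pi / 2) \<longleftrightarrow> (\<forall>p. \<forall>u\<in>\<V> p. \<psi> p u = 0)"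
proof
  assume a: "slant_submersion_with_angle A B F \<phi> \<xi> g gN (pi / 2)"
  show "\<forall>p. \<forall>u\<in>\<V> p. \<psi> p u = 0"
  proof (intro allI ballI)
    fix p u assume u: "u \<in> \<V> p"
    have "g p (\<psi> p u) (\<psi> p u) = 0" using slant_psi_norm[OF a u] by simp
    then show "\<psi> p u = 0" using g_eq_0_iff vertical_tangent[OF psi_vertical[OF u]] by blast
  qed
next
  assume "\<forall>p. \<forall>u\<in>\<V> p. \<psi> p u = 0"
  moreover have "tnorm g p 0 = 0" for p
    using g_zero(1)[OF subspace_0[OF tangent_subspace], of p] by (simp add: tnorm_def)
  ultimately show "slant_submersion_with_angle A B F \<phi> \<xi> g gN (pi / 2)"
    using slant by (simp add: slant_submersion_with_angle_def angle_vertical_def psi_def)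
qed

end

text \<open>In this locale \<open>'a\<close> is the type of points of the manifold, not of the model
  space.\<close>

locale contact_submersion_connection = contact_submersion +
  fixes D :: "'a vfield \<Rightarrow> 'a vfield \<Rightarrow> 'a vfield"
  assumes levi_civita: "levi_civita A g D"
begin

section \<open>The Levi-Civita connection and the two implications\<close>

lemma D_field: "vector_field A X \<Longrightarrow> vector_field A Y \<Longrightarrow> vector_field A (D X Y)"
  using levi_civita by (simp add: levi_civita_def affine_connection_def)

lemma D_zero:
  assumes "vector_field A X"
  shows "D X 0 = 0"
proof -
  have "D X (0 + 0) = D X 0 + D X 0"
    using levi_civita assms vector_field_zero unfolding levi_civita_def affine_connection_def by blast
  then show ?thesis by simp
qed

lemma D_torsion_free:
  "vector_field A X \<Longrightarrow> vector_field A Y \<Longrightarrow> lie_bracket X Y p = D X Y p - D Y X p"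
  using levi_civita unfolding levi_civita_def by (metis minus_apply)

lemma D_metric:
  "vector_field A X \<Longrightarrow> vector_field A Y \<Longrightarrow> vector_field A Z \<Longrightarrow>
    X p (\<lambda>q. g q (Y q) (Z q)) = g p (D X Y p) (Z p) + g p (Y p) (D X Z p)"
  using levi_civita by (simp add: levi_civita_def)

abbreviation "Q p \<equiv> \<psi> p \<circ> \<psi> p"

lemma psi_zero_imp_parallel:
  assumes "\<And>p u. u \<in> \<V> p \<Longrightarrow> \<psi> p u = 0"
  shows "vertically_parallel A B F g D Q"
  unfolding vertically_parallel_def
proof (intro allI impI ext)
  fix U V p f assume U: "vertical_field A B F U" and V: "vertical_field A B F V"
  have UV: "vector_field A U" "vector_field A V" using U V by (auto simp: vertical_field_def)
  have "\<psi> q (\<psi> q (V q)) = 0" for q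
    using V assms psi_zero by (simp add: vertical_field_def)
  then have "(\<lambda>q. Q q (V q)) = 0"
    by (simp add: o_def zero_fun_def)
  moreover have "\<psi> p (vp p (D U V p)) = 0"
    by (intro assms vproj_vertical vector_fieldD(1) D_field UV)
  ultimately show "nabla_endo A B F g D Q U V p f = 0 p f"
    using D_zero[OF UV(1)] by (simp add: nabla_endo_def nabla_hat_def vproj_zero psi_zero)
qed

text \<open>The covariant derivative \<open>(\<nabla>\<^sub>U \<eta>)(V)\<close> of
  \<open>\<eta>\<close> restricted to the fibres, with respect to the induced connection
  \<open>nabla_hat\<close>.\<close>

definition nabla_eta :: "'a vfield \<Rightarrow> 'a vfield \<Rightarrow> 'a \<Rightarrow> real" where
  "nabla_eta U V p = U p (\<lambda>q. \<eta> q (V q)) - \<eta> p (vp p (D U V p))"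

text \<open>
  As \<open>Q = - cos\<^sup>2 \<theta> (I - \<eta> \<otimes> \<eta>\<^sup>\<sharp>)\<close> on the fibres, \<open>\<nabla>Q = 0\<close> says that the symmetric product of
  \<open>\<eta>\<close> and \<open>\<nabla>\<^sub>U \<eta>\<close> vanishes.
\<close>

lemma parallel_nabla_eta:
  assumes slant: "slant_submersion_with_angle A B F \<phi> \<xi> g gN \<theta>" and c: "cos \<theta> \<noteq> 0"
    and par: "vertically_parallel A B F g D Q"
    and U: "vertical_field A B F U" and V: "vertical_field A B F V" and W: "vertical_field A B F W"
  shows "nabla_eta U V p * \<eta> p (W p) + \<eta> p (V p) * nabla_eta U W p = 0"
proof -
  \<comment> \<open>With this \<open>k\<close> the slant formula reads
    \<open>g(QV, W) = k (g(V, W) - \<eta>(V) \<eta>(W))\<close>; the proof differentiates it along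
    \<open>U\<close>.\<close>
  define k where "k = - (cos \<theta>)\<^sup>2"
  have vf: "vector_field A U" "vector_field A V" "vector_field A W"
    and vert: "\<And>q. V q \<in> \<V> q" "\<And>q. W q \<in> \<V> q"
    using U V W by (auto simp: vertical_field_def)
  note Qin = slant_psi_psi_inner[OF slant, folded k_def]
  let ?QV = "\<lambda>q. \<psi> q (\<psi> q (V q))"
  have QV: "vector_field A ?QV" "?QV p \<in> \<V> p"
    using psi_field[OF psi_field[OF V]] by (auto simp: vertical_field_def)
  note t = vector_fieldD(1)[OF D_field[OF vf(1) vf(2)], of p] vector_fieldD(1)[OF D_field[OF vf(1) vf(3)], of p]
    vector_fieldD(1)[OF D_field[OF vf(1) QV(1)], of p]
  have tU: "U p \<in> T p" using vf vector_fieldD(1) by blast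
  let ?x = "g p (D U V p) (W p)" and ?y = "g p (V p) (D U W p)"
  let ?a = "U p (\<lambda>q. \<eta> q (V q))" and ?b = "U p (\<lambda>q. \<eta> q (W q))"
  let ?s = "\<eta> p (vp p (D U V p))" and ?t = "\<eta> p (vp p (D U W p))"
  have "nabla_endo A B F g D Q U V = 0" using par U V by (simp add: vertically_parallel_def)
  from fun_cong[OF this, of p] have "vp p (D U ?QV p) = \<psi> p (\<psi> p (vp p (D U V p)))"
    by (simp add: nabla_endo_def nabla_hat_def o_def)
  \<comment> \<open>As \<open>W\<close> is vertical, only the vertical part of
    \<open>D U ?QV\<close> counts, and parallelism turns it into \<open>Q\<close> applied to the
    vertical part of \<open>D U V\<close>.\<close>
  then have "g p (D U ?QV p) (W p) = g p (\<psi> p (\<psi> p (vp p (D U V p)))) (W p)"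
    using g_vproj(1)[OF t(3) vert(2)] by simp
  also have "\<dots> = k * (?x - ?s * \<eta> p (W p))"
    using Qin[OF vproj_vertical[OF t(1)] vert(2)] g_vproj(1)[OF t(1) vert(2)] by simp
  finally have 1: "g p (D U ?QV p) (W p) = k * (?x - ?s * \<eta> p (W p))" .
  have "g p (?QV p) (D U W p) = g p (?QV p) (vp p (D U W p))"
    using g_vproj(2)[OF t(2) QV(2)] by simp
  also have "\<dots> = k * (?y - \<eta> p (V p) * ?t)"
    using Qin[OF vert(1) vproj_vertical[OF t(2)]] g_vproj(2)[OF t(2) vert(1)] by simp
  finally have 2: "g p (?QV p) (D U W p) = k * (?y - \<eta> p (V p) * ?t)" .
  have s: "smooth_fun A (\<lambda>q. g q (V q) (W q))" "smooth_fun A (\<lambda>q. \<eta> q (V q))" "smooth_fun A (\<lambda>q. \<eta> q (W q))"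
    by (intro smooth_g smooth_eta vf)+
  \<comment> \<open>The right side of the slant formula is differentiated by the product rule, the
    left side below by metric compatibility. Comparing them, \<open>?x\<close> and \<open>?y\<close>
    cancel and only \<open>\<eta>\<close> terms remain.\<close>
  have "U p (\<lambda>q. g q (?QV q) (W q)) = U p (\<lambda>q. k * g q (V q) (W q) + (- k) * (\<eta> q (V q) * \<eta> q (W q)))"
    by (simp add: Qin[OF vert] right_diff_distrib)
  also have "\<dots> = k * U p (\<lambda>q. g q (V q) (W q)) + (- k) * (\<eta> p (V p) * ?b + \<eta> p (W p) * ?a)"
    by (simp add: tangent_lincomb[OF tU s(1) smooth_fun_mult[OF s(2,3)], of k "- k", simplified]
        tangent_mult[OF tU s(2,3)])
  also have "U p (\<lambda>q. g q (V q) (W q)) = ?x + ?y" by (rule D_metric[OF vf])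
  finally have "k * (?x - ?s * \<eta> p (W p)) + k * (?y - \<eta> p (V p) * ?t) =
      k * (?x + ?y) + (- k) * (\<eta> p (V p) * ?b + \<eta> p (W p) * ?a)"
    using D_metric[OF vf(1) QV(1) vf(3), of p] 1 2 by simp
  then have "k * ((?a - ?s) * \<eta> p (W p) + \<eta> p (V p) * (?b - ?t)) = 0" by (simp add: algebra_simps)
  then show ?thesis using c by (simp add: k_def nabla_eta_def)
qed

text \<open>Torsion-freeness makes the bracket a tangent vector; being vertical, it equals its own
  vertical part and so can be computed with the induced connection.\<close>

lemma eta_lie_bracket:
  assumes U: "vertical_field A B F U" and V: "vertical_field A B F V"
  shows "\<eta> p (lie_bracket U V p) = \<eta> p (vp p (D U V p)) - \<eta> p (vp p (D V U p))"
    "lie_bracket U V p \<in> \<V> p"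
proof -
  have vf: "vector_field A U" "vector_field A V" using U V by (auto simp: vertical_field_def)
  note t = vector_fieldD(1)[OF D_field[OF vf], of p] vector_fieldD(1)[OF D_field[OF vf(2,1)], of p]
  note l = D_torsion_free[OF vf, of p]
  have "lie_bracket U V p \<in> T p" unfolding l by (rule subspace_diff[OF tangent_subspace t])
  then show v: "lie_bracket U V p \<in> \<V> p" by (rule lie_bracket_vertical[OF U V])
  have "lie_bracket U V p = vp p (D U V p) - vp p (D V U p)"
    using vproj_ident[OF v] vproj_diff[OF t] l by simp
  then show "\<eta> p (lie_bracket U V p) = \<eta> p (vp p (D U V p)) - \<eta> p (vp p (D V U p))"
    using eta_diff[of "vp p (D U V p)" p "vp p (D V U p)"] vertical_tangent vproj_vertical t by simp
qed

text \<open>If \<open>\<eta> p (V p)\<close> were nonzero, \<open>nabla_eta\<close> would vanish at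
  \<open>p\<close> on vertical fields, and so would its antisymmetrisation
  \<open>d\<eta>(U, W) = g(U, \<phi> W)\<close>, against \<open>nz\<close>.\<close>

lemma parallel_imp_eta_vertical_zero:
  assumes slant: "slant_submersion_with_angle A B F \<phi> \<xi> g gN \<theta>" and c: "cos \<theta> \<noteq> 0"
    and par: "vertically_parallel A B F g D Q"
    and U: "vertical_field A B F U" and W: "vertical_field A B F W"
    and nz: "g p (U p) (\<phi> p (W p)) \<noteq> 0" and V: "vertical_field A B F V"
  shows "\<eta> p (V p) = 0"
proof (rule ccontr)
  assume n: "\<eta> p (V p) \<noteq> 0"
  have 0: "nabla_eta X Y p = 0" if X: "vertical_field A B F X" and Y: "vertical_field A B F Y" for X Y
  proof -
    \<comment> \<open>With both arguments equal to \<open>V\<close> the product relation is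
      \<open>2 * \<eta> p (V p) * nabla_eta X V p = 0\<close>; this in turn removes one of the two
      terms for general \<open>Y\<close>.\<close>
    have "nabla_eta X V p = 0"
      using parallel_nabla_eta[OF slant c par X V V, of p] n by (simp add: mult.commute)
    then show ?thesis using parallel_nabla_eta[OF slant c par X V Y, of p] n by simp
  qed
  have "ext_deriv \<eta> U W p = (nabla_eta U W p - nabla_eta W U p) / 2"
    using eta_lie_bracket(1)[OF U W, of p] by (simp add: ext_deriv_def nabla_eta_def)
  then show False
    using 0[OF U W] 0[OF W U] nz ext_deriv_eta[of U W p] U W by (simp add: vertical_field_def)
qed

text \<open>For \<open>cos \<theta> = 0\<close> the norm formula suffices. Otherwise a nonzero
  \<open>\<psi> p u\<close> makes \<open>g(U, \<phi> W)\<close> nonzero near \<open>p\<close>, so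
  \<open>\<eta>\<close> vanishes there on vertical fields; then \<open>d\<eta>(U, W) = 0\<close> at
  \<open>p\<close>, a contradiction.\<close>

lemma parallel_imp_psi_zero:
  assumes slant: "slant_submersion_with_angle A B F \<phi> \<xi> g gN \<theta>"
    and par: "vertically_parallel A B F g D Q" and u: "u \<in> \<V> p"
  shows "\<psi> p u = 0"
proof (cases "cos \<theta> = 0")
  case True
  then have "g p (\<psi> p u) (\<psi> p u) = 0" using slant_psi_norm[OF slant u] by simp
  then show ?thesis using g_eq_0_iff vertical_tangent[OF psi_vertical[OF u]] by blast
next
  case c: False
  note w = psi_vertical[OF u]
  obtain U where U: "vertical_field A B F U" "U p = u" using vertical_field_extension[OF u] .
  \<comment> \<open>Extending \<open>\<psi> p u\<close> itself makes \<open>g(U, \<phi> W)\<close>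
    at \<open>p\<close> equal to \<open>- |\<psi> u|\<^sup>2\<close>.\<close>
  obtain W where W: "vertical_field A B F W" "W p = \<psi> p u" using vertical_field_extension[OF w] .
  have vf: "vector_field A U" "vector_field A W" using U W by (auto simp: vertical_field_def)
  have s: "smooth_fun A (\<lambda>q. g q (U q) (\<phi> q (W q)))" by (intro smooth_g phi_field vf)
  have gp: "g p (U p) (\<phi> p (W p)) = - g p (\<psi> p u) (\<psi> p u)"
    using g_psi[OF u w] phi_skew[OF vertical_tangent[OF u] vertical_tangent[OF w]] U W by simp
  have "g p (U p) (\<phi> p (W p)) = 0"
  proof (rule ccontr)
    assume "g p (U p) (\<phi> p (W p)) \<noteq> 0"
    then obtain N where N: "open N" "p \<in> N" "\<And>q. q \<in> N \<Longrightarrow> g q (U q) (\<phi> q (W q)) \<noteq> 0"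
      using smooth_fun_nonzero_nbhd[OF s] by blast
    have z: "\<eta> q (V q) = 0" if "q \<in> N" "vertical_field A B F V" for q V
      by (rule parallel_imp_eta_vertical_zero[OF slant c par U(1) W(1) N(3)[OF that(1)] that(2)])
    \<comment> \<open>Here vanishing on the whole neighbourhood \<open>N\<close> matters, since
      \<open>\<eta> q (Y q)\<close> is differentiated at \<open>p\<close>.\<close>
    have d: "X p (\<lambda>q. \<eta> q (Y q)) = 0" if X: "vector_field A X" and Y: "vertical_field A B F Y" for X Y
    proof -
      have "smooth_fun A (\<lambda>q. \<eta> q (Y q))" using Y by (intro smooth_eta) (simp add: vertical_field_def)
      from tangent_local[OF vector_fieldD(1)[OF X] this smooth_fun_const[of 0] N(1,2)] z[OF _ Y]
      show ?thesis using tangent_const[OF vector_fieldD(1)[OF X]] by metis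
    qed
    \<comment> \<open>The bracket is vertical at \<open>p\<close>; extended to a vertical field it
      falls under \<open>z\<close>.\<close>
    obtain Z where Z: "vertical_field A B F Z" "Z p = lie_bracket U W p"
      using vertical_field_extension[OF eta_lie_bracket(2)[OF U(1) W(1)]] .
    have "ext_deriv \<eta> U W p = 0"
      using d[OF vf(1) W(1)] d[OF vf(2) U(1)] z[OF N(2) Z(1)] Z(2) by (simp add: ext_deriv_def)
    then show False using ext_deriv_eta[OF vf, of p] N(2,3) by simp
  qed
  then show ?thesis using gp g_eq_0_iff vertical_tangent[OF w] by auto
qed

end

theorem proposition4:
  fixes AM :: "('m::{t2_space,second_countable_topology}, 'a::euclidean_space) atlas"
    and AN :: "('n::{t2_space,second_countable_topology}, 'b::euclidean_space) atlas"
    and F :: "'m \<Rightarrow> 'n"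
    and \<phi> :: "'m \<Rightarrow> 'm tvec \<Rightarrow> 'm tvec"
    and \<xi> :: "'m vfield"
    and \<eta> :: "'m \<Rightarrow> 'm tvec \<Rightarrow> real"
    and gM :: "'m \<Rightarrow> 'm tvec \<Rightarrow> 'm tvec \<Rightarrow> real"
    and gN :: "'n \<Rightarrow> 'n tvec \<Rightarrow> 'n tvec \<Rightarrow> real"
    and D :: "'m vfield \<Rightarrow> 'm vfield \<Rightarrow> 'm vfield"
    and Q :: "'m \<Rightarrow> 'm tvec \<Rightarrow> 'm tvec"
  assumes "sasakian_manifold AM \<phi> \<xi> \<eta> gM"
    and "riemannian_manifold AN gN"
    and "levi_civita AM gM D"
    and "slant_submersion AM AN F \<phi> \<xi> gM gN"
    and "Q = (\<lambda>p. psi AM AN F gM \<phi> p \<circ> psi AM AN F gM \<phi> p)"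
  shows "vertically_parallel AM AN F gM D Q \<longleftrightarrow>
    anti_invariant_submersion AM AN F \<phi> \<xi> gM gN"
proof -
  obtain \<theta> where slant: "slant_submersion_with_angle AM AN F \<phi> \<xi> gM gN \<theta>"
    using assms(4) by (auto simp: slant_submersion_def)
  interpret contact_submersion_connection AM gM AN F \<phi> \<xi> \<eta> D
    using assms(1-3) slant
    by unfold_locales
      (auto simp: sasakian_manifold_def contact_metric_def almost_contact_metric_def
        riemannian_manifold_def slant_submersion_with_angle_def riemannian_submersion_def)
  \<comment> \<open>Both sides are compared with the vanishing of \<open>\<psi>\<close> on vertical
    vectors.\<close>
  show ?thesis
    unfolding anti_invariant_submersion_def anti_invariant_iff_psi[OF slant] assms(5)
    using parallel_imp_psi_zero[OF slant] psi_zero_imp_parallel by blast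
qed

end
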